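(* Let $G$ be a locally trivial bundle of compact groups. For every base point $x$ and every (finite-dimensional, continuous) representation $\rho$ of the isotropy group $G_x$, there exists a homotopy representation $(E^\bullet,\{R_k\}_{k\ge0})$ of $G$ such that the induced representation of $G_x$ on the degree-zero cohomology group $H^0(E^\bullet_x,\partial_x)$, where $\partial=R_0$, is equivalent to $\rho$.
   Context: Groupoids $G=(G_1\rightrightarrows G_0)$ are locally compact topological groupoids, with source $s$, target $t$, units $1_x$; the product $gh$ is defined when $sg=th$. A locally trivial bundle of compact groups is a groupoid $G$ over a locally compact Hausdorff base $G_0$ with $s=t$ such that each point of $G_0$ has an open neighborhood $U$ for which $G|_U\simeq K\times U$ as bundles of topological groups over $U$, for some compact (Hausdorff) group $K$. The isotropy group $G_x$ is the fiber over $x$. Vector bundles are real or complex (fixed ground field), of finite rank. Graded vector bundles $E^\bullet=\bigoplus_n E^{(n)}$ are $\mathbb{Z}$-graded of finite rank (so $E^{(n)}=0$ for $|n|\gg0$); $\operatorname{Hom}^{(n)}(E^\bullet,F^\bullet)$ is the bundle of degree $n$ linear maps between fibers, and $\operatorname{End}^{(n)}(E^\bullet)=\operatorname{Hom}^{(n)}(E^\bullet,E^\bullet)$. For $k\ge 2$, $G_k$ is the space of composable $k$-tuples $(g_1,\dots,g_k)$, $sg_j=tg_{j+1}$; $t_k,s_k:G_k\to G_0$ are $(g_1,\dots,g_k)\mapsto tg_1$ and $\mapsto sg_k$ (with $t_1=t$, $s_1=s$, and $s_0=t_0=\mathrm{id}_{G_0}$). A homotopy representation of $G$ consists of a graded vector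 bundle $E^\bullet$ over $G_0$ and continuous sections $R_k\in\Gamma(G_k;\operatorname{Hom}^{(1-k)}(s_k^*E^\bullet,t_k^*E^\bullet))$, $k\ge0$, such that for every $k\ge0$ $$\sum_{j=1}^{k-1}(-1)^jR_{k-1}(g_1,\dots,g_jg_{j+1},\dots,g_k)=\sum_{j=0}^k(-1)^jR_j(g_1,\dots,g_j)\circ R_{k-j}(g_{j+1},\dots,g_k),$$ and which is moreover unital up to homotopy: there exists a continuous section $\Upsilon\in\Gamma(G_0;\operatorname{End}^{(-1)}(E^\bullet))$ with $R_1(1_x)-\mathrm{id}_{E^\bullet_x}=\partial_x\circ\Upsilon(x)+\Upsilon(x)\circ\partial_x$ for all $x\in G_0$, where $\partial=R_0$ ($\Upsilon$ is not part of the data). Then $\partial\circ\partial=0$, and the maps $R_1(g)$ induce linear maps $H^i(E^\bullet_{sg},\partial_{sg})\to H^i(E^\bullet_{tg},\partial_{tg})$ which respect composition and units; in particular each isotropy group $G_x$ is represented on $H^i(E^\bullet_x,\partial_x)$. *)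

theory Defs
  imports
    "HOL-Algebra.Algebraic_Closure_Type"
    "HOL-Algebra.Module"
    "HOL-Algebra.AbelCoset"
    "HOL-Algebra.Group_Action"
    "HOL-Analysis.Analysis"
begin

section \<open>Vector spaces on carrier sets\<close>

text \<open>
  The ground field is a type of class \<open>real_normed_field\<close>. By the theorem of Gelfand--Mazur and
  Ostrowski, the real and the complex numbers are, up to isometric isomorphism, the only such
  fields. Vector spaces are modules over this field; the \<open>mult\<close> and \<open>one\<close> fields of the module
  record carry no meaning and are left undefined below.
\<close>

abbreviation scalars :: "'k::field ring"
  where "scalars \<equiv> ring_of_type_algebra"

definition linear_on :: "('k, 'v) module \<Rightarrow> ('k, 'w) module \<Rightarrow> ('v \<Rightarrow> 'w) \<Rightarrow> bool"
  where "linear_on M N L \<longleftrightarrow>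
    L \<in> carrier M \<rightarrow> carrier N \<and>
    (\<forall>v\<in>carrier M. \<forall>w\<in>carrier M. L (v \<oplus>\<^bsub>M\<^esub> w) = L v \<oplus>\<^bsub>N\<^esub> L w) \<and>
    (\<forall>a. \<forall>v\<in>carrier M. L (a \<odot>\<^bsub>M\<^esub> v) = a \<odot>\<^bsub>N\<^esub> L v)"

definition linear_iso :: "('k, 'v) module \<Rightarrow> ('k, 'w) module \<Rightarrow> ('v \<Rightarrow> 'w) \<Rightarrow> bool"
  where "linear_iso M N L \<longleftrightarrow> linear_on M N L \<and> bij_betw L (carrier M) (carrier N)"

definition coord_space :: "nat \<Rightarrow> ('k::field, nat \<Rightarrow> 'k) module"
  where "coord_space n =
    \<lparr>carrier = {..<n} \<rightarrow>\<^sub>E UNIV, monoid.mult = undefined, one = undefined,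
     zero = (\<lambda>i\<in>{..<n}. 0), add = (\<lambda>v w. \<lambda>i\<in>{..<n}. v i + w i),
     module.smult = (\<lambda>a v. \<lambda>i\<in>{..<n}. a * v i)\<rparr>"

definition coord_topology :: "nat \<Rightarrow> (nat \<Rightarrow> 'k::real_normed_field) topology"
  where "coord_topology n = product_topology (\<lambda>_. euclidean) {..<n}"

definition matrix_topology :: "nat \<Rightarrow> nat \<Rightarrow> (nat \<times> nat \<Rightarrow> 'k::real_normed_field) topology"
  where "matrix_topology m n = product_topology (\<lambda>_. euclidean) ({..<m} \<times> {..<n})"

definition mat_apply :: "nat \<Rightarrow> nat \<Rightarrow> (nat \<times> nat \<Rightarrow> 'k::field) \<Rightarrow> (nat \<Rightarrow> 'k) \<Rightarrow> nat \<Rightarrow> 'k"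
  where "mat_apply m n A v = (\<lambda>i\<in>{..<m}. \<Sum>j<n. A (i, j) * v j)"

definition coords :: "nat \<Rightarrow> ((nat \<Rightarrow> 'k::field) \<Rightarrow> 'v) \<Rightarrow> 'v \<Rightarrow> nat \<Rightarrow> 'k"
  where "coords n T = inv_into (carrier (coord_space n)) T"

definition finite_dim_space :: "('k::field, 'v) module \<Rightarrow> bool"
  where "finite_dim_space V \<longleftrightarrow>
    module scalars V \<and> (\<exists>n T. linear_iso (coord_space n) V T)"


section \<open>Representations of topological groups\<close>

definition topological_group :: "('g, 'm) monoid_scheme \<Rightarrow> 'g topology \<Rightarrow> bool"
  where "topological_group K T \<longleftrightarrow>
    group K \<and> topspace T = carrier K \<and>
    continuous_map (prod_topology T T) T (\<lambda>(a, b). a \<otimes>\<^bsub>K\<^esub> b) \<and>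
    continuous_map T T (m_inv K)"

text \<open>
  Continuity refers to the canonical topology of \<open>GL(V)\<close>: with respect to any basis of \<open>V\<close>
  (given as an isomorphism from \<open>k\<^sup>n\<close>), the matrix of \<open>\<rho> g\<close> depends continuously on \<open>g\<close>.
\<close>

definition continuous_representation ::
  "('g, 'm) monoid_scheme \<Rightarrow> 'g topology \<Rightarrow> ('k::real_normed_field, 'v) module \<Rightarrow> ('g \<Rightarrow> 'v \<Rightarrow> 'v) \<Rightarrow> bool"
  where "continuous_representation K T V \<rho> \<longleftrightarrow>
    group_action K (carrier V) \<rho> \<and>
    (\<forall>g\<in>carrier K. linear_on V V (\<rho> g)) \<and>
    (\<forall>n B. linear_iso (coord_space n) V B \<longrightarrow>
      continuous_map T (matrix_topology n n)
        (\<lambda>g. \<lambda>(i, j)\<in>{..<n} \<times> {..<n}.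
           coords n B (\<rho> g (B (\<lambda>l\<in>{..<n}. if l = j then 1 else 0))) i))"

definition equivalent_reps ::
  "('g, 'm) monoid_scheme \<Rightarrow> ('k, 'v) module \<Rightarrow> ('g \<Rightarrow> 'v \<Rightarrow> 'v) \<Rightarrow>
   ('k, 'w) module \<Rightarrow> ('g \<Rightarrow> 'w \<Rightarrow> 'w) \<Rightarrow> bool"
  where "equivalent_reps K V \<rho> W \<sigma> \<longleftrightarrow>
    (\<exists>T. linear_iso V W T \<and> (\<forall>g\<in>carrier K. \<forall>v\<in>carrier V. T (\<rho> g v) = \<sigma> g (T v)))"


section \<open>Groupoids\<close>

record ('x, 'g) groupoid =
  Obj :: "'x topology"
  Arr :: "'g topology"
  src :: "'g \<Rightarrow> 'x"
  tgt :: "'g \<Rightarrow> 'x"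
  idt :: "'x \<Rightarrow> 'g"
  cmp :: "'g \<Rightarrow> 'g \<Rightarrow> 'g"
  ivt :: "'g \<Rightarrow> 'g"

locale topological_groupoid =
  fixes G :: "('x, 'g) groupoid"
  assumes loc_compact: "locally_compact_space (Obj G)" "locally_compact_space (Arr G)"
    and src_cont: "continuous_map (Arr G) (Obj G) (src G)"
    and tgt_cont: "continuous_map (Arr G) (Obj G) (tgt G)"
    and idt_cont: "continuous_map (Obj G) (Arr G) (idt G)"
    and ivt_cont: "continuous_map (Arr G) (Arr G) (ivt G)"
    and cmp_cont:
      "continuous_map (subtopology (prod_topology (Arr G) (Arr G)) {(g, h). src G g = tgt G h})
         (Arr G) (\<lambda>(g, h). cmp G g h)"
    and src_idt: "x \<in> topspace (Obj G) \<Longrightarrow> src G (idt G x) = x"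
    and tgt_idt: "x \<in> topspace (Obj G) \<Longrightarrow> tgt G (idt G x) = x"
    and src_cmp: "\<lbrakk>g \<in> topspace (Arr G); h \<in> topspace (Arr G); src G g = tgt G h\<rbrakk>
      \<Longrightarrow> src G (cmp G g h) = src G h"
    and tgt_cmp: "\<lbrakk>g \<in> topspace (Arr G); h \<in> topspace (Arr G); src G g = tgt G h\<rbrakk>
      \<Longrightarrow> tgt G (cmp G g h) = tgt G g"
    and cmp_assoc:
      "\<lbrakk>f \<in> topspace (Arr G); g \<in> topspace (Arr G); h \<in> topspace (Arr G);
        src G f = tgt G g; src G g = tgt G h\<rbrakk>
      \<Longrightarrow> cmp G (cmp G f g) h = cmp G f (cmp G g h)"
    and idt_cmp: "g \<in> topspace (Arr G) \<Longrightarrow> cmp G (idt G (tgt G g)) g = g"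
    and cmp_idt: "g \<in> topspace (Arr G) \<Longrightarrow> cmp G g (idt G (src G g)) = g"
    and src_ivt: "g \<in> topspace (Arr G) \<Longrightarrow> src G (ivt G g) = tgt G g"
    and tgt_ivt: "g \<in> topspace (Arr G) \<Longrightarrow> tgt G (ivt G g) = src G g"
    and ivt_cmp: "g \<in> topspace (Arr G) \<Longrightarrow> cmp G (ivt G g) g = idt G (src G g)"
    and cmp_ivt: "g \<in> topspace (Arr G) \<Longrightarrow> cmp G g (ivt G g) = idt G (tgt G g)"

definition isotropy :: "('x, 'g) groupoid \<Rightarrow> 'x \<Rightarrow> 'g monoid"
  where "isotropy G x =
    \<lparr>carrier = {g \<in> topspace (Arr G). src G g = x \<and> tgt G g = x}, monoid.mult = cmp G, one = idt G x\<rparr>"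

definition isotropy_topology :: "('x, 'g) groupoid \<Rightarrow> 'x \<Rightarrow> 'g topology"
  where "isotropy_topology G x = subtopology (Arr G) (carrier (isotropy G x))"

text \<open>
  It is no restriction that the model group \<open>K\<close> lives on the type of arrows: near a point \<open>x\<close>
  it is isomorphic to the isotropy group at \<open>x\<close>.
\<close>

locale bundle_of_compact_groups = topological_groupoid G
  for G :: "('x, 'g) groupoid" +
  assumes Hausdorff_Obj: "Hausdorff_space (Obj G)"
    and src_eq_tgt: "g \<in> topspace (Arr G) \<Longrightarrow> src G g = tgt G g"
    and locally_trivial:
      "x \<in> topspace (Obj G) \<Longrightarrow>
       \<exists>U (K :: 'g monoid) T \<phi>.
         openin (Obj G) U \<and> x \<in> U \<and>
         topological_group K T \<and> compact_space T \<and> Hausdorff_space T \<and>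
         homeomorphic_map (prod_topology T (subtopology (Obj G) U))
           (subtopology (Arr G) {g \<in> topspace (Arr G). src G g \<in> U}) \<phi> \<and>
         (\<forall>k\<in>carrier K. \<forall>u\<in>U. src G (\<phi> (k, u)) = u) \<and>
         (\<forall>k\<in>carrier K. \<forall>l\<in>carrier K. \<forall>u\<in>U. \<phi> (k \<otimes>\<^bsub>K\<^esub> l, u) = cmp G (\<phi> (k, u)) (\<phi> (l, u)))"

text \<open>
  An element of \<open>G\<^sub>k\<close> is encoded as \<open>(x, g)\<close>, where \<open>g\<close> is a composable tuple indexed by
  \<open>{1..k}\<close> and \<open>x\<close> is its target. For \<open>k \<ge> 1\<close> the point \<open>x\<close> is redundant (it equals \<open>t g\<^sub>1\<close>);
  for \<open>k = 0\<close> the tuple is empty and only \<open>x\<close> remains. So \<open>G\<^sub>0\<close> is the base, \<open>G\<^sub>1\<close> the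
  space of arrows, and \<open>s\<^sub>0 = t\<^sub>0 = id\<close>.
\<close>

definition nerve :: "('x, 'g) groupoid \<Rightarrow> nat \<Rightarrow> ('x \<times> (nat \<Rightarrow> 'g)) topology"
  where "nerve G k =
    subtopology (prod_topology (Obj G) (product_topology (\<lambda>_. Arr G) {1..k}))
      {(x, g). (1 \<le> k \<longrightarrow> x = tgt G (g 1)) \<and> (\<forall>j\<in>{1..<k}. src G (g j) = tgt G (g (Suc j)))}"

definition nerve_tgt :: "'x \<times> (nat \<Rightarrow> 'g) \<Rightarrow> 'x"
  where "nerve_tgt c = fst c"

definition nerve_src :: "('x, 'g) groupoid \<Rightarrow> nat \<Rightarrow> 'x \<times> (nat \<Rightarrow> 'g) \<Rightarrow> 'x"
  where "nerve_src G k c = (if k = 0 then fst c else src G (snd c k))"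

text \<open>\<open>(g\<^sub>1, \<dots>, g\<^sub>k) \<mapsto> (g\<^sub>1, \<dots>, g\<^sub>j g\<^sub>j\<^sub>+\<^sub>1, \<dots>, g\<^sub>k)\<close> for \<open>1 \<le> j < k\<close>\<close>

definition nerve_face :: "('x, 'g) groupoid \<Rightarrow> nat \<Rightarrow> nat \<Rightarrow> 'x \<times> (nat \<Rightarrow> 'g) \<Rightarrow> 'x \<times> (nat \<Rightarrow> 'g)"
  where "nerve_face G k j c =
    (fst c, \<lambda>i\<in>{1..k - 1}.
       if i < j then snd c i else if i = j then cmp G (snd c j) (snd c (Suc j)) else snd c (Suc i))"

text \<open>\<open>(g\<^sub>1, \<dots>, g\<^sub>k) \<mapsto> (g\<^sub>1, \<dots>, g\<^sub>j)\<close> and \<open>(g\<^sub>1, \<dots>, g\<^sub>k) \<mapsto> (g\<^sub>j\<^sub>+\<^sub>1, \<dots>, g\<^sub>k)\<close> for \<open>0 \<le> j \<le> k\<close>\<close>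

definition nerve_front :: "nat \<Rightarrow> 'x \<times> (nat \<Rightarrow> 'g) \<Rightarrow> 'x \<times> (nat \<Rightarrow> 'g)"
  where "nerve_front j c = (fst c, restrict (snd c) {1..j})"

definition nerve_back :: "('x, 'g) groupoid \<Rightarrow> nat \<Rightarrow> nat \<Rightarrow> 'x \<times> (nat \<Rightarrow> 'g) \<Rightarrow> 'x \<times> (nat \<Rightarrow> 'g)"
  where "nerve_back G k j c = (nerve_src G j c, \<lambda>i\<in>{1..k - j}. snd c (j + i))"

definition obj_simplex :: "'x \<Rightarrow> 'x \<times> (nat \<Rightarrow> 'g)"
  where "obj_simplex x = (x, \<lambda>_. undefined)"

definition arr_simplex :: "('x, 'g) groupoid \<Rightarrow> 'g \<Rightarrow> 'x \<times> (nat \<Rightarrow> 'g)"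
  where "arr_simplex G g = (tgt G g, \<lambda>i\<in>{1}. g)"


section \<open>Vector bundles\<close>

record ('k, 'x, 'e) vbundle =
  base :: "'x topology"
  tot_space :: "'e topology"
  bproj :: "'e \<Rightarrow> 'x"
  fibre :: "'x \<Rightarrow> ('k, 'e) module"

definition trivialization ::
  "('k::real_normed_field, 'x, 'e) vbundle \<Rightarrow> 'x set \<Rightarrow> nat \<Rightarrow> ('x \<times> (nat \<Rightarrow> 'k) \<Rightarrow> 'e) \<Rightarrow> bool"
  where "trivialization E U n \<phi> \<longleftrightarrow>
    openin (base E) U \<and>
    homeomorphic_map (prod_topology (subtopology (base E) U) (coord_topology n))
      (subtopology (tot_space E) {e \<in> topspace (tot_space E). bproj E e \<in> U}) \<phi> \<and>
    (\<forall>y\<in>U. linear_iso (coord_space n) (fibre E y) (\<lambda>v. \<phi> (y, v)))"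

definition vector_bundle :: "('k::real_normed_field, 'x, 'e) vbundle \<Rightarrow> bool"
  where "vector_bundle E \<longleftrightarrow>
    continuous_map (tot_space E) (base E) (bproj E) \<and>
    (\<forall>x\<in>topspace (base E).
       module scalars (fibre E x) \<and>
       carrier (fibre E x) = {e \<in> topspace (tot_space E). bproj E e = x}) \<and>
    (\<forall>x\<in>topspace (base E). \<exists>U n \<phi>. x \<in> U \<and> trivialization E U n \<phi>)"

text \<open>
  The bundle \<open>Hom(f\<^sup>*E, h\<^sup>*F)\<close> over \<open>Y\<close>, for maps \<open>f\<close>, \<open>h\<close> from \<open>Y\<close> to the bases of \<open>E\<close>, \<open>F\<close>.
  Its fibre over \<open>y\<close> consists of the linear maps from \<open>E\<close> at \<open>f y\<close> to \<open>F\<close> at \<open>h y\<close>, and it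
  carries the topology glued from the charts that any local trivializations of \<open>E\<close> and \<open>F\<close>
  induce: a set is open iff its preimage under each chart is.
\<close>

definition hom_total ::
  "'y topology \<Rightarrow> ('y \<Rightarrow> 'x) \<Rightarrow> ('k, 'x, 'e) vbundle \<Rightarrow> ('y \<Rightarrow> 'z) \<Rightarrow> ('k, 'z, 'f) vbundle \<Rightarrow>
   ('y \<times> ('e \<Rightarrow> 'f)) set"
  where "hom_total Y f E h F =
    {(y, L). y \<in> topspace Y \<and> L \<in> extensional (carrier (fibre E (f y))) \<and>
             linear_on (fibre E (f y)) (fibre F (h y)) L}"

definition hom_chart ::
  "('y \<Rightarrow> 'x) \<Rightarrow> ('k::real_normed_field, 'x, 'e) vbundle \<Rightarrow> nat \<Rightarrow> ('x \<times> (nat \<Rightarrow> 'k) \<Rightarrow> 'e) \<Rightarrow>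
   ('y \<Rightarrow> 'z) \<Rightarrow> nat \<Rightarrow> ('z \<times> (nat \<Rightarrow> 'k) \<Rightarrow> 'f) \<Rightarrow>
   'y \<times> (nat \<times> nat \<Rightarrow> 'k) \<Rightarrow> 'y \<times> ('e \<Rightarrow> 'f)"
  where "hom_chart f E n \<phi> h m \<psi> = (\<lambda>(y, A).
    (y, \<lambda>e\<in>carrier (fibre E (f y)).
          \<psi> (h y, mat_apply m n A (coords n (\<lambda>v. \<phi> (f y, v)) e))))"

definition hom_open ::
  "'y topology \<Rightarrow> ('y \<Rightarrow> 'x) \<Rightarrow> ('k::real_normed_field, 'x, 'e) vbundle \<Rightarrow> ('y \<Rightarrow> 'z) \<Rightarrow>
   ('k, 'z, 'f) vbundle \<Rightarrow> ('y \<times> ('e \<Rightarrow> 'f)) set \<Rightarrow> bool"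
  where "hom_open Y f E h F W \<longleftrightarrow>
    W \<subseteq> hom_total Y f E h F \<and>
    (\<forall>U n \<phi> V m \<psi>. trivialization E U n \<phi> \<longrightarrow> trivialization F V m \<psi> \<longrightarrow>
       (let D = prod_topology (subtopology Y {y. f y \<in> U \<and> h y \<in> V}) (matrix_topology m n)
        in openin D {p \<in> topspace D. hom_chart f E n \<phi> h m \<psi> p \<in> W}))"

definition hom_topology ::
  "'y topology \<Rightarrow> ('y \<Rightarrow> 'x) \<Rightarrow> ('k::real_normed_field, 'x, 'e) vbundle \<Rightarrow> ('y \<Rightarrow> 'z) \<Rightarrow>
   ('k, 'z, 'f) vbundle \<Rightarrow> ('y \<times> ('e \<Rightarrow> 'f)) topology"
  where "hom_topology Y f E h F = topology (hom_open Y f E h F)"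

lemma istopology_hom_open: "istopology (hom_open Y f E h F)"
  unfolding istopology_def
proof (intro conjI allI impI)
  fix S T assume S: "hom_open Y f E h F S" and T: "hom_open Y f E h F T"
  have eq: "{p \<in> A. c p \<in> S \<inter> T} = {p \<in> A. c p \<in> S} \<inter> {p \<in> A. c p \<in> T}"
    for A and c :: "_ \<Rightarrow> _"
    by blast
  show "hom_open Y f E h F (S \<inter> T)"
    using S T unfolding hom_open_def Let_def eq by (blast intro: openin_Int)
next
  fix \<K> assume K: "\<forall>S\<in>\<K>. hom_open Y f E h F S"
  have eq: "{p \<in> A. c p \<in> \<Union>\<K>} = (\<Union>S\<in>\<K>. {p \<in> A. c p \<in> S})" for A and c :: "_ \<Rightarrow> _"
    by blast
  show "hom_open Y f E h F (\<Union>\<K>)"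
    using K unfolding hom_open_def Let_def eq by (blast intro: openin_Union)
qed

lemma openin_hom_topology: "openin (hom_topology Y f E h F) = hom_open Y f E h F"
  by (simp add: hom_topology_def istopology_hom_open)

definition hom_section ::
  "'y topology \<Rightarrow> ('y \<Rightarrow> 'x) \<Rightarrow> ('k::real_normed_field, 'x, 'e) vbundle \<Rightarrow> ('y \<Rightarrow> 'z) \<Rightarrow>
   ('k, 'z, 'f) vbundle \<Rightarrow> ('y \<Rightarrow> 'e \<Rightarrow> 'f) \<Rightarrow> bool"
  where "hom_section Y f E h F L \<longleftrightarrow> continuous_map Y (hom_topology Y f E h F) (\<lambda>y. (y, L y))"

definition graded_vector_bundle ::
  "'x topology \<Rightarrow> (int \<Rightarrow> ('k::real_normed_field, 'x, 'e) vbundle) \<Rightarrow> bool"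
  where "graded_vector_bundle B E \<longleftrightarrow>
    (\<forall>n. vector_bundle (E n) \<and> base (E n) = B) \<and>
    (\<exists>N. \<forall>n. \<bar>n\<bar> > N \<longrightarrow> (\<forall>x\<in>topspace B. carrier (fibre (E n) x) = {\<zero>\<^bsub>fibre (E n) x\<^esub>}))"


section \<open>Homotopy representations\<close>

text \<open>
  \<open>R k n c\<close> is the component of \<open>R\<^sub>k(c)\<close> on the degree \<open>n\<close> part of the fibre over \<open>s\<^sub>k c\<close>;
  it takes values in degree \<open>n + 1 - k\<close> over \<open>t\<^sub>k c\<close>.
\<close>

type_synonym ('x, 'g, 'e) rep_data = "nat \<Rightarrow> int \<Rightarrow> 'x \<times> (nat \<Rightarrow> 'g) \<Rightarrow> 'e \<Rightarrow> 'e"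

definition rep_diff :: "('x, 'g, 'e) rep_data \<Rightarrow> 'x \<Rightarrow> int \<Rightarrow> 'e \<Rightarrow> 'e"
  where "rep_diff R x n = R 0 n (obj_simplex x)"

definition homotopy_representation ::
  "('x, 'g) groupoid \<Rightarrow> (int \<Rightarrow> ('k::real_normed_field, 'x, 'e) vbundle) \<Rightarrow> ('x, 'g, 'e) rep_data \<Rightarrow> bool"
  where "homotopy_representation G E R \<longleftrightarrow>
    graded_vector_bundle (Obj G) E \<and>
    (\<forall>k n. hom_section (nerve G k) (nerve_src G k) (E n) nerve_tgt (E (n + 1 - int k)) (R k n)) \<and>
    (\<forall>k n. \<forall>c\<in>topspace (nerve G k). \<forall>e\<in>carrier (fibre (E n) (nerve_src G k c)).
       let M = fibre (E (n + 2 - int k)) (nerve_tgt c) in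
         (\<Oplus>\<^bsub>M\<^esub>j\<in>{1..k - 1}. (- 1) ^ j \<odot>\<^bsub>M\<^esub> R (k - 1) n (nerve_face G k j c) e) =
         (\<Oplus>\<^bsub>M\<^esub>j\<in>{0..k}. (- 1) ^ j \<odot>\<^bsub>M\<^esub>
            R j (n + 1 - int (k - j)) (nerve_front j c) (R (k - j) n (nerve_back G k j c) e))) \<and>
    (\<exists>\<Upsilon>. (\<forall>n. hom_section (Obj G) id (E n) id (E (n - 1)) (\<Upsilon> n)) \<and>
       (\<forall>n. \<forall>x\<in>topspace (Obj G). \<forall>e\<in>carrier (fibre (E n) x).
          R 1 n (arr_simplex G (idt G x)) e \<ominus>\<^bsub>fibre (E n) x\<^esub> e =
          rep_diff R x (n - 1) (\<Upsilon> n x e) \<oplus>\<^bsub>fibre (E n) x\<^esub> \<Upsilon> (n + 1) x (rep_diff R x n e)))"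

definition cocycles ::
  "(int \<Rightarrow> ('k, 'x, 'e) vbundle) \<Rightarrow> ('x, 'g, 'e) rep_data \<Rightarrow> int \<Rightarrow> 'x \<Rightarrow> 'e set"
  where "cocycles E R n x =
    {e \<in> carrier (fibre (E n) x). rep_diff R x n e = \<zero>\<^bsub>fibre (E (n + 1)) x\<^esub>}"

definition coboundaries ::
  "(int \<Rightarrow> ('k, 'x, 'e) vbundle) \<Rightarrow> ('x, 'g, 'e) rep_data \<Rightarrow> int \<Rightarrow> 'x \<Rightarrow> 'e set"
  where "coboundaries E R n x = rep_diff R x (n - 1) ` carrier (fibre (E (n - 1)) x)"

definition cohomology ::
  "(int \<Rightarrow> ('k, 'x, 'e) vbundle) \<Rightarrow> ('x, 'g, 'e) rep_data \<Rightarrow> int \<Rightarrow> 'x \<Rightarrow> ('k, 'e set) module"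
  where "cohomology E R n x = (let M = fibre (E n) x; B = coboundaries E R n x in
    \<lparr>carrier = {B +>\<^bsub>M\<^esub> z | z. z \<in> cocycles E R n x}, monoid.mult = undefined, one = undefined,
     zero = B, add = (\<lambda>C D. C <+>\<^bsub>M\<^esub> D),
     module.smult = (\<lambda>a C. \<Union>c\<in>C. B +>\<^bsub>M\<^esub> (a \<odot>\<^bsub>M\<^esub> c))\<rparr>)"

definition cohomology_action ::
  "('x, 'g) groupoid \<Rightarrow> (int \<Rightarrow> ('k, 'x, 'e) vbundle) \<Rightarrow> ('x, 'g, 'e) rep_data \<Rightarrow> int \<Rightarrow>
   'g \<Rightarrow> 'e set \<Rightarrow> 'e set"
  where "cohomology_action G E R n g C =
    (\<Union>c\<in>C. coboundaries E R n (tgt G g) +>\<^bsub>fibre (E n) (tgt G g)\<^esub> R 1 n (arr_simplex G g) c)"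

end

theory Submission
  imports Defs
begin

text \<open>
  A local trivialization of \<open>G\<close> over a neighbourhood \<open>U\<close> of \<open>x\<close> extends \<open>\<rho>\<close> to a representation \<open>\<rho>'\<close>
  of \<open>G\<close> over \<open>U\<close> on the trivial bundle with fibre \<open>V\<close>. Let \<open>\<theta>\<close> be a bump function with \<open>\<theta> x = 1\<close>
  and closed support inside \<open>U\<close>. The matrices \<open>S g = \<theta> \<rho>' g\<close>, extended by \<open>0\<close>, are continuous on all
  of \<open>G\<close> and satisfy \<open>S g S h = \<theta> S (g h)\<close> and \<open>S 1 = \<theta>\<close>. These two identities are exactly what is
  needed for \<open>R\<^sub>0 = 1 - \<theta> : E\<^sup>0 \<rightarrow> E\<^sup>1\<close>, \<open>R\<^sub>1 g = S g\<close>, \<open>R\<^sub>2 (g, h) = - S (g h) : E\<^sup>1 \<rightarrow> E\<^sup>0\<close> and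
  \<open>R\<^sub>k = 0\<close> for \<open>k \<ge> 3\<close> to be a homotopy representation on two copies of the trivial bundle, in
  degrees 0 and 1; \<open>- 1 : E\<^sup>1 \<rightarrow> E\<^sup>0\<close> is a homotopy from the identity to \<open>R\<^sub>1\<close> on units. At \<open>x\<close> the
  differential vanishes, so the cohomology in degree 0 is \<open>V\<close> with \<open>\<rho>\<close>.
\<close>

section \<open>Coordinate spaces and trivial bundles\<close>

lemma carrier_coord_space [simp]: "carrier (coord_space n) = {..<n} \<rightarrow>\<^sub>E UNIV"
  and zero_coord_space [simp]: "\<zero>\<^bsub>coord_space n\<^esub> = (\<lambda>i\<in>{..<n}. 0)"
  and add_coord_space [simp]: "v \<oplus>\<^bsub>coord_space n\<^esub> w = (\<lambda>i\<in>{..<n}. v i + w i)"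
  and smult_coord_space [simp]: "a \<odot>\<^bsub>coord_space n\<^esub> v = (\<lambda>i\<in>{..<n}. a * v i)"
  by (simp_all add: coord_space_def)

lemma topspace_coord_topology [simp]: "topspace (coord_topology n) = {..<n} \<rightarrow>\<^sub>E UNIV"
  by (simp add: coord_topology_def)

text \<open>Vectors carry their base point, so that the fibre over \<open>y\<close> is literally a
  subset of the total space, as \<open>vector_bundle\<close> demands. The operations read only
  second components.\<close>

definition coord_fibre :: "nat \<Rightarrow> 'x \<Rightarrow> ('k::field, 'x \<times> (nat \<Rightarrow> 'k)) module"
  where "coord_fibre n y =
    \<lparr>carrier = {y} \<times> ({..<n} \<rightarrow>\<^sub>E UNIV), monoid.mult = undefined, one = undefined,
     zero = (y, \<lambda>i\<in>{..<n}. 0), add = (\<lambda>v w. (y, \<lambda>i\<in>{..<n}. snd v i + snd w i)),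
     module.smult = (\<lambda>a v. (y, \<lambda>i\<in>{..<n}. a * snd v i))\<rparr>"

lemma carrier_coord_fibre [simp]: "carrier (coord_fibre n y) = {y} \<times> ({..<n} \<rightarrow>\<^sub>E UNIV)"
  and zero_coord_fibre [simp]: "\<zero>\<^bsub>coord_fibre n y\<^esub> = (y, \<lambda>i\<in>{..<n}. 0)"
  and add_coord_fibre [simp]:
    "v \<oplus>\<^bsub>coord_fibre n y\<^esub> w = (y, \<lambda>i\<in>{..<n}. snd v i + snd w i)"
  and smult_coord_fibre [simp]: "a \<odot>\<^bsub>coord_fibre n y\<^esub> v = (y, \<lambda>i\<in>{..<n}. a * snd v i)"
  by (simp_all add: coord_fibre_def)

lemma abelian_group_coord_fibre: "abelian_group (coord_fibre n y)"
proof (rule abelian_groupI)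
  fix v assume "v \<in> carrier (coord_fibre n y)"
  then show "\<exists>w\<in>carrier (coord_fibre n y). w \<oplus>\<^bsub>coord_fibre n y\<^esub> v = \<zero>\<^bsub>coord_fibre n y\<^esub>"
    by (intro bexI[of _ "(y, \<lambda>i\<in>{..<n}. - snd v i)"]) (simp_all cong: restrict_cong)
qed (clarsimp simp: add_ac PiE_restrict cong: restrict_cong)+

lemma module_coord_fibre: "module scalars (coord_fibre n y)"
  by (rule moduleI[OF cring_from_type_algebra abelian_group_coord_fibre])
    (clarsimp simp: ring_of_type_algebra_def algebra_simps PiE_restrict cong: restrict_cong)+

text \<open>The structure equation is stated with \<open>finsum\<close> in a fibre; this turns it
  into scalar identities, one per coordinate.\<close>

lemma finsum_coord_fibre:
  assumes "finite J" and "\<And>j. j \<in> J \<Longrightarrow> f j \<in> carrier (coord_fibre n y)"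
  shows "(\<Oplus>\<^bsub>coord_fibre n y\<^esub>j\<in>J. f j) = (y, \<lambda>i\<in>{..<n}. \<Sum>j\<in>J. snd (f j) i)"
proof -
  interpret abelian_group "coord_fibre n y"
    by (rule abelian_group_coord_fibre)
  show ?thesis
    using assms
  proof (induction J rule: finite_induct)
    case (insert j J)
    have "finsum (coord_fibre n y) f (insert j J) = f j \<oplus>\<^bsub>coord_fibre n y\<^esub> finsum (coord_fibre n y) f J"
      using insert by (intro finsum_insert) (auto simp del: carrier_coord_fibre)
    also have "finsum (coord_fibre n y) f J = (y, \<lambda>i\<in>{..<n}. \<Sum>j\<in>J. snd (f j) i)"
      using insert.prems by (intro insert.IH) simp
    also have "f j \<oplus>\<^bsub>coord_fibre n y\<^esub> \<dots> = (y, \<lambda>i\<in>{..<n}. \<Sum>j\<in>insert j J. snd (f j) i)"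
      using insert.hyps by (simp add: fun_eq_iff)
    finally show ?case .
  qed simp
qed

lemma minus_coord_fibre:
  assumes "v \<in> carrier (coord_fibre n y)" "w \<in> carrier (coord_fibre n y)"
  shows "v \<ominus>\<^bsub>coord_fibre n y\<^esub> w = (y, \<lambda>i\<in>{..<n}. snd v i - snd w i)"
proof -
  interpret abelian_group "coord_fibre n y"
    by (rule abelian_group_coord_fibre)
  have "\<ominus>\<^bsub>coord_fibre n y\<^esub> w = (y, \<lambda>i\<in>{..<n}. - snd w i)"
    using assms by (intro minus_equality) (simp_all cong: restrict_cong)
  then show ?thesis
    by (simp add: a_minus_def cong: restrict_cong)
qed

text \<open>Addition of cohomology classes at \<open>x\<close>, which will turn out to be singletons
  because the coboundaries there are zero.\<close>

lemma set_add_singleton: "{v} <+>\<^bsub>coord_fibre m y\<^esub> {w} = {v \<oplus>\<^bsub>coord_fibre m y\<^esub> w}"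
  by (simp add: set_add_def')

lemma zero_coset:
  assumes "w \<in> carrier (coord_fibre m y)"
  shows "{\<zero>\<^bsub>coord_fibre m y\<^esub>} +>\<^bsub>coord_fibre m y\<^esub> w = {w}"
proof -
  interpret abelian_group "coord_fibre m y"
    by (rule abelian_group_coord_fibre)
  show ?thesis
    using assms by (simp add: a_r_coset_def' del: zero_coord_fibre add_coord_fibre carrier_coord_fibre)
qed

section \<open>Trivial vector bundles\<close>

definition trivial_bundle :: "'x topology \<Rightarrow> nat \<Rightarrow> ('k::real_normed_field, 'x, 'x \<times> (nat \<Rightarrow> 'k)) vbundle"
  where "trivial_bundle B n =
    \<lparr>base = B, tot_space = prod_topology B (coord_topology n), bproj = fst, fibre = coord_fibre n\<rparr>"

lemma trivial_bundle_simps [simp]: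
  "base (trivial_bundle B n) = B"
  "tot_space (trivial_bundle B n) = prod_topology B (coord_topology n)"
  "bproj (trivial_bundle B n) = fst"
  "fibre (trivial_bundle B n) = coord_fibre n"
  by (simp_all add: trivial_bundle_def)

lemma linear_iso_coord_fibre: "linear_iso (coord_space n) (coord_fibre n y) (\<lambda>v. (y, v))"
  unfolding linear_iso_def linear_on_def bij_betw_def inj_on_def
  by (simp add: image_iff set_eq_iff Pi_iff)

lemma trivialization_trivial_bundle:
  "trivialization (trivial_bundle B n) (topspace B) n id"
proof -
  \<comment> \<open>The part of the total space over the whole base is everything, so the
    subtopology in \<open>trivialization\<close> is the full topology and the identity serves as a
    global chart.\<close>
  have "{e \<in> topspace (tot_space (trivial_bundle B n)). bproj (trivial_bundle B n) e \<in> topspace B} =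
      topspace (prod_topology B (coord_topology n))"
    by (simp add: set_eq_iff) blast
  from subtopology_topspace[of "prod_topology B (coord_topology n)", folded this] show ?thesis
    by (simp add: trivialization_def linear_iso_coord_fibre del: topspace_prod_topology)
qed

lemma vector_bundle_trivial_bundle: "vector_bundle (trivial_bundle B n)"
  unfolding vector_bundle_def
proof (intro conjI ballI)
  fix x assume x: "x \<in> topspace (base (trivial_bundle B n))"
  then show "\<exists>U m \<phi>. x \<in> U \<and> trivialization (trivial_bundle B n) U m \<phi>"
    using trivialization_trivial_bundle[of B n] by auto
  show "carrier (fibre (trivial_bundle B n) x) =
      {e \<in> topspace (tot_space (trivial_bundle B n)). bproj (trivial_bundle B n) e = x}"
    using x by (simp add: set_eq_iff) blast
qed (simp_all add: module_coord_fibre continuous_map_fst)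

section \<open>Linear maps in coordinates\<close>

lemma linear_on_comp:
  assumes "linear_on V W L" "linear_on W Z M"
  shows "linear_on V Z (\<lambda>v. M (L v))"
  using assms unfolding linear_on_def by (auto simp: Pi_iff)

lemma mat_apply_PiE: "mat_apply m n A v \<in> {..<m} \<rightarrow>\<^sub>E UNIV"
  by (simp add: mat_apply_def)

text \<open>The action of a row of a scalar matrix. R_0 and the homotopy for the units are given by
  such matrices.\<close>

lemma sum_diag_mult:
  fixes a :: "'a::semiring_0" and m :: nat
  assumes "i < m"
  shows "(\<Sum>j<m. (if i = j then a else 0) * w j) = a * w i"
proof -
  have "(\<Sum>j<m. (if i = j then a else 0) * w j) = (\<Sum>j<m. if i = j then a * w j else 0)"
    by (intro sum.cong) auto
  then show ?thesis
    using assms by simp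
qed

lemma linear_on_mat_apply: "linear_on (coord_space n) (coord_space m) (mat_apply m n A)"
  unfolding linear_on_def
  by (auto simp: mat_apply_def fun_eq_iff sum.distrib sum_distrib_left algebra_simps)

lemma linear_iso_coords:
  assumes "linear_iso (coord_space n) V T"
  shows "v \<in> {..<n} \<rightarrow>\<^sub>E UNIV \<Longrightarrow> coords n T (T v) = v"
    and "e \<in> carrier V \<Longrightarrow> T (coords n T e) = e"
    and "e \<in> carrier V \<Longrightarrow> coords n T e \<in> {..<n} \<rightarrow>\<^sub>E UNIV"
proof -
  have T: "bij_betw T ({..<n} \<rightarrow>\<^sub>E UNIV) (carrier V)"
    using assms by (simp add: linear_iso_def)
  show "v \<in> {..<n} \<rightarrow>\<^sub>E UNIV \<Longrightarrow> coords n T (T v) = v"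
    using T by (simp add: coords_def bij_betw_inv_into_left)
  show "e \<in> carrier V \<Longrightarrow> T (coords n T e) = e"
    using T by (simp add: coords_def bij_betw_inv_into_right)
  show "e \<in> carrier V \<Longrightarrow> coords n T e \<in> {..<n} \<rightarrow>\<^sub>E UNIV"
    using bij_betw_apply[OF bij_betw_inv_into[OF T]] by (simp add: coords_def)
qed

lemma linear_on_coords:
  assumes T: "linear_iso (coord_space n) V T"
  shows "linear_on V (coord_space n) (coords n T)"
  unfolding linear_on_def
proof (intro conjI ballI allI)
  note c = linear_iso_coords[OF T]
  have T': "linear_on (coord_space n) V T"
    using T by (simp add: linear_iso_def)
  show "coords n T \<in> carrier V \<rightarrow> carrier (coord_space n)"
    using c by auto
  fix v w assume "v \<in> carrier V" "w \<in> carrier V"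
  then show "coords n T (v \<oplus>\<^bsub>V\<^esub> w) = coords n T v \<oplus>\<^bsub>coord_space n\<^esub> coords n T w"
    using T' c(2,3)[of v] c(2,3)[of w] c(1)[of "coords n T v \<oplus>\<^bsub>coord_space n\<^esub> coords n T w"]
    unfolding linear_on_def by auto
next
  note c = linear_iso_coords[OF T]
  have T': "linear_on (coord_space n) V T"
    using T by (simp add: linear_iso_def)
  fix a v assume "v \<in> carrier V"
  then show "coords n T (a \<odot>\<^bsub>V\<^esub> v) = a \<odot>\<^bsub>coord_space n\<^esub> coords n T v"
    using T' c(2,3)[of v] c(1)[of "a \<odot>\<^bsub>coord_space n\<^esub> coords n T v"]
    unfolding linear_on_def by auto
qed

text \<open>Linearity of \<open>M\<close> evaluates it at sums and multiples; the closure
  assumptions keep these in the carrier, where \<open>M\<close> is known to agree with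
  \<open>L\<close>.\<close>

lemma linear_on_cong:
  assumes "linear_on V W L" "\<And>v. v \<in> carrier V \<Longrightarrow> M v = L v"
    "\<And>v w. v \<in> carrier V \<Longrightarrow> w \<in> carrier V \<Longrightarrow> v \<oplus>\<^bsub>V\<^esub> w \<in> carrier V"
    "\<And>a v. v \<in> carrier V \<Longrightarrow> a \<odot>\<^bsub>V\<^esub> v \<in> carrier V"
  shows "linear_on V W M"
  using assms unfolding linear_on_def by (auto simp: Pi_iff)

text \<open>Each element of \<open>V\<close> is the image of its coordinates, so closure is
  transported along \<open>T\<close> from the coordinate space.\<close>

lemma linear_iso_closed:
  assumes "linear_iso (coord_space n) V T"
  shows "v \<in> carrier V \<Longrightarrow> w \<in> carrier V \<Longrightarrow> v \<oplus>\<^bsub>V\<^esub> w \<in> carrier V"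
    and "v \<in> carrier V \<Longrightarrow> a \<odot>\<^bsub>V\<^esub> v \<in> carrier V"
proof -
  note c = linear_iso_coords[OF assms]
  have T: "linear_on (coord_space n) V T"
    using assms by (simp add: linear_iso_def)
  show "v \<oplus>\<^bsub>V\<^esub> w \<in> carrier V" if "v \<in> carrier V" "w \<in> carrier V"
  proof -
    have "T (coords n T v \<oplus>\<^bsub>coord_space n\<^esub> coords n T w) = v \<oplus>\<^bsub>V\<^esub> w"
      using that T c unfolding linear_on_def by simp
    moreover have "T (coords n T v \<oplus>\<^bsub>coord_space n\<^esub> coords n T w) \<in> carrier V"
      using T unfolding linear_on_def by (auto simp: Pi_iff)
    ultimately show ?thesis by simp
  qed
  show "a \<odot>\<^bsub>V\<^esub> v \<in> carrier V" if "v \<in> carrier V"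
  proof -
    have "T (a \<odot>\<^bsub>coord_space n\<^esub> coords n T v) = a \<odot>\<^bsub>V\<^esub> v"
      using that T c unfolding linear_on_def by simp
    moreover have "T (a \<odot>\<^bsub>coord_space n\<^esub> coords n T v) \<in> carrier V"
      using T unfolding linear_on_def by (auto simp: Pi_iff)
    ultimately show ?thesis by simp
  qed
qed

section \<open>Continuous sections of Hom bundles\<close>

lemma hom_chart_in_hom_total:
  assumes E: "trivialization E U n \<phi>" and F: "trivialization F V m \<psi>"
    and "y \<in> topspace Y" "f y \<in> U" "h y \<in> V"
  shows "hom_chart f E n \<phi> h m \<psi> (y, A) \<in> hom_total Y f E h F"
proof -
  let ?T = "\<lambda>v. \<phi> (f y, v)"
  have T: "linear_iso (coord_space n) (fibre E (f y)) ?T"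
    and T': "linear_on (coord_space m) (fibre F (h y)) (\<lambda>v. \<psi> (h y, v))"
    using assms by (auto simp: trivialization_def linear_iso_def)
  \<comment> \<open>A chart value is a composite of three linear maps: coordinates of
    \<open>E\<close>, the matrix, and the trivialization of \<open>F\<close>.\<close>
  have "linear_on (fibre E (f y)) (fibre F (h y))
      (\<lambda>e. \<psi> (h y, mat_apply m n A (coords n ?T e)))"
    by (intro linear_on_comp[OF linear_on_comp[OF linear_on_coords[OF T] linear_on_mat_apply] T'])
  then have "linear_on (fibre E (f y)) (fibre F (h y))
      (\<lambda>e\<in>carrier (fibre E (f y)). \<psi> (h y, mat_apply m n A (coords n ?T e)))"
    by (rule linear_on_cong) (simp_all add: linear_iso_closed[OF T])
  then show ?thesis
    using assms by (simp add: hom_chart_def hom_total_def)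
qed

text \<open>The total set is itself open, since its preimage under every chart is the whole domain
  of the chart; every open set lies in it by definition.\<close>

lemma topspace_hom_topology: "topspace (hom_topology Y f E h F) = hom_total Y f E h F"
proof -
  have "hom_open Y f E h F (hom_total Y f E h F)"
    unfolding hom_open_def Let_def
  proof (intro conjI allI impI subset_refl)
    fix U n \<phi> V m \<psi>
    assume "trivialization E U n \<phi>" "trivialization F V m \<psi>"
    from hom_chart_in_hom_total[OF this]
    have "{p \<in> topspace D. hom_chart f E n \<phi> h m \<psi> p \<in> hom_total Y f E h F} = topspace D"
      if "D = prod_topology (subtopology Y {y. f y \<in> U \<and> h y \<in> V}) (matrix_topology m n)" for D
      using that by auto
    then show "openin (prod_topology (subtopology Y {y. f y \<in> U \<and> h y \<in> V}) (matrix_topology m n))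
        {p \<in> topspace (prod_topology (subtopology Y {y. f y \<in> U \<and> h y \<in> V}) (matrix_topology m n)).
          hom_chart f E n \<phi> h m \<psi> p \<in> hom_total Y f E h F}"
      by (metis openin_topspace)
  qed
  moreover have "\<And>W. hom_open Y f E h F W \<Longrightarrow> W \<subseteq> hom_total Y f E h F"
    by (simp add: hom_open_def)
  ultimately show ?thesis
    unfolding topspace_def openin_hom_topology by blast
qed

text \<open>
  The topology of the Hom bundle is final with respect to the charts, so a section that factors
  continuously through the one global chart is continuous.
\<close>

lemma hom_section_trivial_bundle:
  fixes A :: "'y \<Rightarrow> nat \<times> nat \<Rightarrow> 'k::real_normed_field"
  assumes f: "f ` topspace Y \<subseteq> topspace B" and h: "h ` topspace Y \<subseteq> topspace Z"
    and A: "\<And>i j. i < m \<Longrightarrow> j < n \<Longrightarrow> continuous_map Y euclidean (\<lambda>y. A y (i, j))"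
  shows "hom_section Y f (trivial_bundle B n) h (trivial_bundle Z m)
    (\<lambda>y. \<lambda>e\<in>carrier (coord_fibre n (f y)). (h y, mat_apply m n (A y) (snd e)))"
    (is "hom_section Y f ?E h ?F ?L")
proof -
  \<comment> \<open>\<open>c\<close> is the section read in the global chart. Points of
    \<open>matrix_topology\<close> are extensional, hence the restriction to the index set.\<close>
  define c where "c y = (y, restrict (A y) ({..<m} \<times> {..<n}))" for y
  define D where "D = prod_topology (subtopology Y {y. f y \<in> topspace B \<and> h y \<in> topspace Z})
    (matrix_topology m n :: (nat \<times> nat \<Rightarrow> 'k) topology)"
  have Y: "subtopology Y {y. f y \<in> topspace B \<and> h y \<in> topspace Z} = Y"
    using f h by (intro subtopology_superset) auto
  have c: "continuous_map Y D c"
    unfolding D_def Y c_def matrix_topology_def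
    by (auto simp: continuous_map_pairwise o_def continuous_map_componentwise A)
  have chart: "hom_chart f ?E n id h m id (c y) = (y, ?L y)" for y
  proof -
    have "coords n (\<lambda>v. (f y, v)) e = snd e" if "e \<in> carrier (coord_fibre n (f y))" for e :: "_ \<times> (nat \<Rightarrow> 'k)"
      using that unfolding coords_def by (intro inv_into_f_eq) (simp_all add: inj_on_def mem_Times_iff prod_eq_iff)
    then have "(\<lambda>e\<in>carrier (coord_fibre n (f y)).
          (h y, mat_apply m n (snd (c y)) (coords n (\<lambda>v. (f y, v)) e))) = ?L y"
      by (intro restrict_ext) (simp add: c_def mat_apply_def cong: restrict_cong)
    then show ?thesis
      by (simp add: hom_chart_def c_def del: carrier_coord_fibre)
  qed
  note E = trivialization_trivial_bundle[of B n]
    and F = trivialization_trivial_bundle[of Z m]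
  show ?thesis
    unfolding hom_section_def continuous_map_def
  proof (intro conjI allI impI)
    show "(\<lambda>y. (y, ?L y)) \<in> topspace Y \<rightarrow> topspace (hom_topology Y f ?E h ?F)"
    proof
      fix y assume "y \<in> topspace Y"
      with f h have "hom_chart f ?E n id h m id (c y) \<in> hom_total Y f ?E h ?F"
        unfolding c_def by (intro hom_chart_in_hom_total[OF E F]) auto
      then show "(y, ?L y) \<in> topspace (hom_topology Y f ?E h ?F)"
        by (simp only: chart topspace_hom_topology)
    qed
    \<comment> \<open>Openness of \<open>W\<close> is a condition on all pairs of charts; it is
      applied to the two global ones, and the preimage of \<open>W\<close> under the section is a
      preimage under \<open>c\<close>.\<close>
    fix W assume "openin (hom_topology Y f ?E h ?F) W"
    then have "openin D {p \<in> topspace D. hom_chart f ?E n id h m id p \<in> W}"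
      using E F unfolding openin_hom_topology hom_open_def Let_def D_def by blast
    from openin_continuous_map_preimage[OF c this]
    have "openin Y {y \<in> topspace Y. c y \<in> {p \<in> topspace D. hom_chart f ?E n id h m id p \<in> W}}" .
    moreover have "c y \<in> topspace D" if "y \<in> topspace Y" for y
      using c that by (auto simp: continuous_map_def)
    ultimately show "openin Y {y \<in> topspace Y. (y, ?L y) \<in> W}"
      by (simp add: chart cong: conj_cong)
  qed
qed

section \<open>Matrices of endomorphisms\<close>

definition rep_matrix :: "nat \<Rightarrow> ((nat \<Rightarrow> 'k::field) \<Rightarrow> 'v) \<Rightarrow> ('v \<Rightarrow> 'v) \<Rightarrow> nat \<times> nat \<Rightarrow> 'k"
  where "rep_matrix n T L = (\<lambda>(i, j)\<in>{..<n} \<times> {..<n}.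
    coords n T (L (T (\<lambda>l\<in>{..<n}. if l = j then 1 else 0))) i)"

text \<open>Truncating \<open>v\<close> to its first \<open>k\<close> coordinates and inducting on
  \<open>k\<close> adds one multiple of a basis vector at a time; \<open>k = n\<close> gives back
  \<open>v\<close>.\<close>

lemma linear_on_expand:
  fixes M :: "(nat \<Rightarrow> 'k::field) \<Rightarrow> nat \<Rightarrow> 'k"
  assumes M: "linear_on (coord_space n) (coord_space m) M" and v: "v \<in> {..<n} \<rightarrow>\<^sub>E UNIV" and i: "i < m"
  shows "M v i = (\<Sum>j<n. M (\<lambda>l\<in>{..<n}. if l = j then 1 else 0) i * v j)"
proof -
  have add: "M (\<lambda>l\<in>{..<n}. v l + w l) = (\<lambda>l\<in>{..<m}. M v l + M w l)"
    if "v \<in> {..<n} \<rightarrow>\<^sub>E UNIV" "w \<in> {..<n} \<rightarrow>\<^sub>E UNIV" for v w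
    using M that unfolding linear_on_def by simp
  have smult: "M (\<lambda>l\<in>{..<n}. a * v l) = (\<lambda>l\<in>{..<m}. a * M v l)"
    if "v \<in> {..<n} \<rightarrow>\<^sub>E UNIV" for a v
    using M that unfolding linear_on_def by simp
  \<comment> \<open>The zero vector is reached as \<open>0\<close> times \<open>v\<close>.\<close>
  have zero: "M (\<lambda>l\<in>{..<n}. 0) i = 0"
    using fun_cong[OF smult[OF v, of 0], of i] i by simp
  have "M (\<lambda>l\<in>{..<n}. if l < k then v l else 0) i =
      (\<Sum>j<k. M (\<lambda>l\<in>{..<n}. if l = j then 1 else 0) i * v j)" if "k \<le> n" for k
    using that
  proof (induction k)
    case 0
    then show ?case
      using zero by (simp only: not_less0 if_False lessThan_0 sum.empty)
  next
    case (Suc k)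
    let ?e = "\<lambda>l\<in>{..<n}. if l = k then 1 else (0::'k)"
    let ?w = "\<lambda>l\<in>{..<n}. if l < k then v l else 0"
    have "(\<lambda>l\<in>{..<n}. if l < Suc k then v l else 0) = (\<lambda>l\<in>{..<n}. ?w l + (\<lambda>l\<in>{..<n}. v k * ?e l) l)"
      by (auto simp: fun_eq_iff less_Suc_eq)
    moreover have "M (\<lambda>l\<in>{..<n}. ?w l + (\<lambda>l\<in>{..<n}. v k * ?e l) l) =
        (\<lambda>l\<in>{..<m}. M ?w l + M (\<lambda>l\<in>{..<n}. v k * ?e l) l)"
      by (rule add) (simp_all only: restrict_PiE_iff UNIV_I ball_triv simp_thms)
    moreover have "M (\<lambda>l\<in>{..<n}. v k * ?e l) = (\<lambda>l\<in>{..<m}. v k * M ?e l)"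
      by (rule smult) (simp only: restrict_PiE_iff UNIV_I ball_triv simp_thms)
    ultimately have "M (\<lambda>l\<in>{..<n}. if l < Suc k then v l else 0) i = M ?w i + v k * M ?e i"
      using i by simp
    also have "M ?w i = (\<Sum>j<k. M (\<lambda>l\<in>{..<n}. if l = j then 1 else 0) i * v j)"
      using Suc.prems by (intro Suc.IH) linarith
    finally show ?case
      by (simp only: sum.lessThan_Suc mult.commute)
  qed
  from this[of n] have "M (\<lambda>l\<in>{..<n}. v l) i = (\<Sum>j<n. M (\<lambda>l\<in>{..<n}. if l = j then 1 else 0) i * v j)"
    by (simp cong: restrict_cong)
  then show ?thesis
    using v by (simp add: PiE_restrict)
qed

lemma rep_matrix_apply:
  assumes T: "linear_iso (coord_space n) V T" and L: "linear_on V V L" and v: "v \<in> {..<n} \<rightarrow>\<^sub>E UNIV"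
  shows "mat_apply n n (rep_matrix n T L) v = coords n T (L (T v))"
proof -
  have lin: "linear_on (coord_space n) (coord_space n) (\<lambda>v. coords n T (L (T v)))"
    using T by (intro linear_on_comp[OF linear_on_comp[OF _ L] linear_on_coords[OF T]])
      (simp add: linear_iso_def)
  have "coords n T (L (T v)) \<in> {..<n} \<rightarrow>\<^sub>E UNIV"
    using lin v unfolding linear_on_def by (simp add: Pi_iff)
  then have "coords n T (L (T v)) = (\<lambda>i\<in>{..<n}. coords n T (L (T v)) i)"
    by (simp add: PiE_restrict)
  also have "\<dots> = mat_apply n n (rep_matrix n T L) v"
    unfolding mat_apply_def
    by (intro restrict_ext) (simp add: rep_matrix_def linear_on_expand[OF lin v])
  finally show ?thesis ..
qed

text \<open>Column \<open>j\<close> of the matrix of \<open>M\<close> is the coordinate vector of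
  \<open>M\<close> at the \<open>j\<close>-th basis vector; applying the matrix of \<open>L\<close>
  to it gives column \<open>j\<close> for the composite.\<close>

lemma rep_matrix_mult:
  assumes T: "linear_iso (coord_space n) V T" and L: "linear_on V V L" and M: "linear_on V V M"
    and "i < n" "j < n"
  shows "(\<Sum>l<n. rep_matrix n T L (i, l) * rep_matrix n T M (l, j)) = rep_matrix n T (\<lambda>v. L (M v)) (i, j)"
proof -
  let ?e = "\<lambda>l\<in>{..<n}. if l = j then 1 else 0"
  let ?w = "coords n T (M (T ?e))"
  have Te: "T ?e \<in> carrier V"
    using T unfolding linear_iso_def linear_on_def by (simp add: Pi_iff)
  then have M': "M (T ?e) \<in> carrier V"
    using M unfolding linear_on_def by (simp add: Pi_iff)
  have "(\<Sum>l<n. rep_matrix n T L (i, l) * rep_matrix n T M (l, j)) = mat_apply n n (rep_matrix n T L) ?w i"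
    using assms(4,5) by (simp add: mat_apply_def rep_matrix_def)
  also have "\<dots> = coords n T (L (M (T ?e))) i"
    using linear_iso_coords[OF T] M' by (simp add: rep_matrix_apply[OF T L])
  finally show ?thesis
    using assms(4,5) by (simp add: rep_matrix_def)
qed

lemma rep_matrix_id:
  assumes T: "linear_iso (coord_space n) V T" and "\<And>v. v \<in> carrier V \<Longrightarrow> L v = v" "i < n" "j < n"
  shows "rep_matrix n T L (i, j) = (if i = j then 1 else 0)"
proof -
  let ?e = "\<lambda>l\<in>{..<n}. if l = j then 1 else 0"
  have "T ?e \<in> carrier V"
    using T unfolding linear_iso_def linear_on_def by (simp add: Pi_iff)
  then show ?thesis
    using assms linear_iso_coords(1)[OF T, of ?e] by (simp add: rep_matrix_def)
qed

lemma rep_matrix_cong: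
  assumes T: "linear_iso (coord_space n) V T" and "\<And>v. v \<in> carrier V \<Longrightarrow> L v = M v"
  shows "rep_matrix n T L = rep_matrix n T M"
proof -
  have "T (\<lambda>l\<in>{..<n}. if l = j then 1 else 0) \<in> carrier V" for j
    using T unfolding linear_iso_def linear_on_def by (simp add: Pi_iff)
  then show ?thesis
    using assms(2) by (simp add: rep_matrix_def)
qed

section \<open>The nerve of a bundle of groups\<close>

context bundle_of_compact_groups
begin

lemma nerve_objD:
  assumes "c \<in> topspace (nerve G k)"
  shows "fst c \<in> topspace (Obj G)"
  using assms by (auto simp: nerve_def)

text \<open>Since source and target agree, composability propagates one base point along the whole
  tuple. Hence all face, front and back maps of the nerve stay over \<open>fst c\<close>.\<close>

lemma nerve_arrD:
  assumes c: "c \<in> topspace (nerve G k)" and "1 \<le> j" "j \<le> k"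
  shows "snd c j \<in> topspace (Arr G)" "tgt G (snd c j) = fst c" "src G (snd c j) = fst c"
proof -
  have arr: "snd c i \<in> topspace (Arr G)" if "1 \<le> i" "i \<le> k" for i
    using c that by (auto simp: nerve_def PiE_iff)
  show "tgt G (snd c j) = fst c"
    using \<open>1 \<le> j\<close> \<open>j \<le> k\<close>
  proof (induction j rule: dec_induct)
    case base
    then show ?case
      using c by (auto simp: nerve_def)
  next
    case (step i)
    then have "src G (snd c i) = tgt G (snd c (Suc i))"
      using c by (auto simp: nerve_def)
    then show ?case
      using step src_eq_tgt[OF arr[of i]] by simp
  qed
  with assms arr show "snd c j \<in> topspace (Arr G)" "src G (snd c j) = fst c"
    by (auto simp: src_eq_tgt)
qed

lemma nerve_src_eq:
  assumes "c \<in> topspace (nerve G k)" "j \<le> k"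
  shows "nerve_src G j c = fst c"
  using assms nerve_arrD[of c k j] by (auto simp: nerve_src_def)

lemma nerve_src_front:
  assumes "c \<in> topspace (nerve G k)" "j \<le> k"
  shows "nerve_src G j (nerve_front j c) = fst c"
  using assms nerve_arrD[of c k j] by (auto simp: nerve_src_def nerve_front_def)

lemma nerve_src_back:
  assumes "c \<in> topspace (nerve G k)" "j \<le> k"
  shows "nerve_src G (k - j) (nerve_back G k j c) = fst c"
  using assms nerve_arrD[of c k k] nerve_src_eq[of c k j]
  by (auto simp: nerve_src_def[of G "k - j"] nerve_back_def)

lemma nerve_src_face:
  assumes c: "c \<in> topspace (nerve G k)" and "1 \<le> j" "j < k"
  shows "nerve_src G (k - 1) (nerve_face G k j c) = fst c"
proof -
  have "src G (cmp G (snd c j) (snd c (Suc j))) = fst c"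
    using assms nerve_arrD[OF c] by (subst src_cmp) auto
  then show ?thesis
    using assms nerve_arrD[OF c, of k] by (auto simp: nerve_src_def nerve_face_def)
qed

lemma continuous_map_nerve_fst: "continuous_map (nerve G k) (Obj G) fst"
  unfolding nerve_def by (intro continuous_map_from_subtopology continuous_map_fst)

lemma continuous_map_nerve_arr:
  assumes "1 \<le> j" "j \<le> k"
  shows "continuous_map (nerve G k) (Arr G) (\<lambda>c. snd c j)"
  unfolding nerve_def using assms
  by (intro continuous_map_from_subtopology continuous_map_compose[OF continuous_map_snd, unfolded o_def]
      continuous_map_product_projection) auto

text \<open>Contained in the continuity of composition, because a continuous map sends the
  underlying space of its domain into that of its codomain.\<close>

lemma cmp_closed:
  assumes "g \<in> topspace (Arr G)" "h \<in> topspace (Arr G)" "src G g = tgt G h"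
  shows "cmp G g h \<in> topspace (Arr G)"
  using continuous_map_image_subset_topspace[OF cmp_cont] assms by (force simp: image_subset_iff)

lemma continuous_map_nerve_cmp:
  "continuous_map (nerve G 2) (Arr G) (\<lambda>c. cmp G (snd c 1) (snd c 2))"
proof -
  have "continuous_map (nerve G 2)
      (subtopology (prod_topology (Arr G) (Arr G)) {(g, h). src G g = tgt G h}) (\<lambda>c. (snd c 1, snd c 2))"
    by (auto simp: continuous_map_in_subtopology continuous_map_pairwise o_def
        continuous_map_nerve_arr nerve_arrD)
  from continuous_map_compose[OF this cmp_cont] show ?thesis
    by (simp add: o_def)
qed

end

section \<open>Homotopy representations from representations up to scale\<close>

text \<open>
  Where \<open>\<theta>\<close> does not vanish, \<open>S / \<theta>\<close> is a representation; where it vanishes, products of values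
  of \<open>S\<close> are zero, so \<open>S\<close> can be cut off to \<open>0\<close>.
\<close>

locale scaled_representation = bundle_of_compact_groups G
  for G :: "('x, 'g) groupoid" +
  fixes d :: nat and \<theta> :: "'x \<Rightarrow> 'k::real_normed_field" and S :: "'g \<Rightarrow> nat \<times> nat \<Rightarrow> 'k"
  assumes scale_cont: "continuous_map (Obj G) euclidean \<theta>"
    and mat_cont: "i < d \<Longrightarrow> j < d \<Longrightarrow> continuous_map (Arr G) euclidean (\<lambda>g. S g (i, j))"
    and mat_cmp:
      "\<lbrakk>g \<in> topspace (Arr G); h \<in> topspace (Arr G); src G g = tgt G h; i < d; j < d\<rbrakk>
       \<Longrightarrow> (\<Sum>l<d. S g (i, l) * S h (l, j)) = \<theta> (tgt G g) * S (cmp G g h) (i, j)"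
    and mat_idt:
      "\<lbrakk>y \<in> topspace (Obj G); i < d; j < d\<rbrakk> \<Longrightarrow> S (idt G y) (i, j) = (if i = j then \<theta> y else 0)"
begin

section \<open>The graded bundle and its operators\<close>

definition rk :: "int \<Rightarrow> nat"
  where "rk n = (if n = 0 \<or> n = 1 then d else 0)"

definition rep_bundle :: "int \<Rightarrow> ('k, 'x, 'x \<times> (nat \<Rightarrow> 'k)) vbundle"
  where "rep_bundle n = trivial_bundle (Obj G) (rk n)"

text \<open>The matrix does not depend on the degree: the ranks \<open>rk\<close> cut it down,
  leaving R_0 only from degree 0 to 1, R_1 on both degrees, and R_2 only from degree 1 to 0.\<close>

definition rep_mat :: "nat \<Rightarrow> 'x \<times> (nat \<Rightarrow> 'g) \<Rightarrow> nat \<times> nat \<Rightarrow> 'k"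
  where "rep_mat k c = (\<lambda>(i, j).
    if k = 0 then (if i = j then 1 - \<theta> (fst c) else 0)
    else if k = 1 then S (snd c 1) (i, j)
    else if k = 2 then - S (cmp G (snd c 1) (snd c 2)) (i, j) else 0)"

text \<open>Restricted to the fibre because elements of \<open>hom_total\<close> are
  extensional.\<close>

definition rep_ops :: "('x, 'g, 'x \<times> (nat \<Rightarrow> 'k)) rep_data"
  where "rep_ops k n c = (\<lambda>e\<in>carrier (coord_fibre (rk n) (nerve_src G k c)).
    (nerve_tgt c, mat_apply (rk (n + 1 - int k)) (rk n) (rep_mat k c) (snd e)))"

lemma fibre_rep_bundle [simp]: "fibre (rep_bundle n) = coord_fibre (rk n)"
  by (simp add: rep_bundle_def)

lemma graded_vector_bundle_rep_bundle: "graded_vector_bundle (Obj G) rep_bundle"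
  unfolding graded_vector_bundle_def
proof (intro conjI allI exI[of _ 1] impI ballI)
  fix n :: int and y assume "1 < \<bar>n\<bar>"
  then have "rk n = 0"
    by (auto simp: rk_def)
  then show "carrier (fibre (rep_bundle n) y) = {\<zero>\<^bsub>fibre (rep_bundle n) y\<^esub>}"
    by (simp add: restrict_def)
qed (simp_all add: rep_bundle_def vector_bundle_trivial_bundle)

lemma rk_le: "rk n \<le> d"
  by (simp add: rk_def)

lemma hom_section_rep_ops:
  "hom_section (nerve G k) (nerve_src G k) (rep_bundle n) nerve_tgt (rep_bundle (n + 1 - int k))
     (rep_ops k n)"
proof -
  have "continuous_map (nerve G k) euclidean (\<lambda>c. rep_mat k c (i, j))"
    if "i < rk (n + 1 - int k)" "j < rk n" for i j
  proof -
    have ij: "i < d" "j < d"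
      using that rk_le[of n] rk_le[of "n + 1 - int k"] by auto
    note comp = continuous_map_compose[unfolded o_def]
    consider "k = 0" | "k = 1" | "k = 2" | "k > 2"
      by linarith
    then show ?thesis
    proof cases
      case 1
      have "continuous_map (nerve G k) euclidean (\<lambda>c. \<theta> (fst c))"
        by (rule comp[OF continuous_map_nerve_fst scale_cont])
      then show ?thesis
        using 1 by (simp add: rep_mat_def continuous_map_diff)
    next
      case 2
      then show ?thesis
        using comp[OF continuous_map_nerve_arr[of 1 1] mat_cont[OF ij]] by (simp add: rep_mat_def)
    next
      case 3
      then show ?thesis
        using comp[OF continuous_map_nerve_cmp mat_cont[OF ij]]
        by (simp add: rep_mat_def continuous_map_minus)
    next
      case 4
      then show ?thesis
        by (simp add: rep_mat_def)
    qed
  qed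
  then show ?thesis
    unfolding rep_bundle_def rep_ops_def
    by (intro hom_section_trivial_bundle) (auto simp: nerve_src_eq nerve_tgt_def dest: nerve_objD)
qed

section \<open>The structure equation\<close>

lemma rep_ops_apply:
  assumes "nerve_src G k c = y" "fst c = y" "v \<in> {..<rk n} \<rightarrow>\<^sub>E UNIV"
  shows "rep_ops k n c (y, v) = (y, mat_apply (rk (n + 1 - int k)) (rk n) (rep_mat k c) v)"
  using assms by (simp add: rep_ops_def nerve_tgt_def)

text \<open>The form in which \<open>mat_cmp\<close> enters the structure equation, where composites
  of operators appear as nested applications to a vector.\<close>

lemma mat_mult_vec:
  assumes "g \<in> topspace (Arr G)" "h \<in> topspace (Arr G)" "src G g = tgt G h" "i < d"
  shows "(\<Sum>l<d. S g (i, l) * (\<Sum>j<d. S h (l, j) * v j)) =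
    \<theta> (tgt G g) * (\<Sum>j<d. S (cmp G g h) (i, j) * v j)"
proof -
  have "(\<Sum>l<d. S g (i, l) * (\<Sum>j<d. S h (l, j) * v j)) = (\<Sum>l<d. \<Sum>j<d. S g (i, l) * S h (l, j) * v j)"
    by (simp add: sum_distrib_left mult.assoc)
  also have "\<dots> = (\<Sum>j<d. (\<Sum>l<d. S g (i, l) * S h (l, j)) * v j)"
    by (subst sum.swap) (simp add: sum_distrib_right)
  also have "\<dots> = (\<Sum>j<d. \<theta> (tgt G g) * S (cmp G g h) (i, j) * v j)"
    using assms by (simp add: mat_cmp)
  finally show ?thesis
    by (simp add: sum_distrib_left mult.assoc)
qed

text \<open>Both sides vanish if the source has rank zero. Otherwise source degree \<open>n\<close>
  and target degree \<open>n + 2 - k\<close> both lie in {0, 1}, which leaves four cases, settled by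
  \<open>mat_mult_vec\<close> and associativity.\<close>

lemma rep_equation_coords:
  assumes c: "c \<in> topspace (nerve G k)" and i: "i < rk (n + 2 - int k)"
  shows "(\<Sum>j\<in>{1..k - 1}. (- 1) ^ j *
      mat_apply (rk (n + 2 - int k)) (rk n) (rep_mat (k - 1) (nerve_face G k j c)) v i) =
    (\<Sum>j\<in>{0..k}. (- 1) ^ j *
      mat_apply (rk (n + 2 - int k)) (rk (n + 1 - int (k - j))) (rep_mat j (nerve_front j c))
       (mat_apply (rk (n + 1 - int (k - j))) (rk n) (rep_mat (k - j) (nerve_back G k j c)) v) i)"
proof (cases "rk n = 0")
  case True
  then show ?thesis
    using i by (simp add: mat_apply_def)
next
  case False
  note arr = nerve_arrD[OF c]
  let ?x = "fst c"
  have i': "i < d"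
    using i rk_le le_less_trans less_le_trans by blast
  have sum_factor: "(\<Sum>l<d. A (i, l) * (b * w l)) = b * (\<Sum>l<d. A (i, l) * w l)" for A w and b :: 'k
    by (simp add: sum_distrib_left mult.left_commute)
  have "n = 0 \<or> n = 1" "n + 2 - int k = 0 \<or> n + 2 - int k = 1"
    using i False by (auto simp: rk_def split: if_splits)
  then consider "n = 0" "k = 1" | "n = 0" "k = 2" | "n = 1" "k = 2" | "n = 1" "k = 3"
    by linarith
  then show ?thesis
  proof cases
    \<comment> \<open>The scalar R_0 = 1 - \<theta> commutes with R_1 = S.\<close>
    case 1
    then show ?thesis
      using i' by (simp add: mat_apply_def rep_mat_def nerve_front_def nerve_back_def rk_def sum_diag_mult sum_factor
          nerve_src_eq[OF c])
  next
    \<comment> \<open>With S = S(g h), the right side is - R_1 R_1 + R_2 R_0 = - \<theta> S - (1 -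
      \<theta>) S = - S, the left side.\<close>
    case 2
    then show ?thesis
      using i' arr[of 1] arr[of 2] mat_mult_vec[of "snd c 1" "snd c 2"]
      by (simp add: mat_apply_def rep_mat_def nerve_front_def nerve_back_def nerve_face_def
          rk_def sum_diag_mult sum_factor sum_negf cmp_closed src_cmp tgt_cmp numeral_2_eq_2 numeral_3_eq_3 nerve_src_eq[OF c])
        (simp_all add: algebra_simps)
  next
    \<comment> \<open>The same computation in degree 1, with R_0 R_2 in place of R_2 R_0.\<close>
    case 3
    then show ?thesis
      using i' arr[of 1] arr[of 2] mat_mult_vec[of "snd c 1" "snd c 2"]
      by (simp add: mat_apply_def rep_mat_def nerve_front_def nerve_back_def nerve_face_def
          rk_def sum_diag_mult sum_factor sum_negf cmp_closed src_cmp tgt_cmp numeral_2_eq_2 numeral_3_eq_3 nerve_src_eq[OF c])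
        (simp_all add: algebra_simps)
  next
    \<comment> \<open>On the left the two faces give the same triple product with opposite signs. On
      the right S(g1) S(g2 g3) - S(g1 g2) S(g3) vanishes, since both terms are \<theta> S(g1 g2
      g3).\<close>
    case 4
    then show ?thesis
      using i' arr[of 1] arr[of 2] arr[of 3] mat_mult_vec[of "cmp G (snd c 1) (snd c 2)" "snd c 3"]
        mat_mult_vec[of "snd c 1" "cmp G (snd c 2) (snd c 3)"] cmp_assoc[of "snd c 1" "snd c 2" "snd c 3"]
      by (simp add: mat_apply_def rep_mat_def nerve_front_def nerve_back_def nerve_face_def
          rk_def sum_diag_mult sum_factor sum_negf cmp_closed src_cmp tgt_cmp numeral_2_eq_2 numeral_3_eq_3 nerve_src_eq[OF c])
  qed
qed

lemma rep_equation:
  assumes c: "c \<in> topspace (nerve G k)" and e: "e \<in> carrier (fibre (rep_bundle n) (nerve_src G k c))"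
    and M: "M = fibre (rep_bundle (n + 2 - int k)) (nerve_tgt c)"
  shows "(\<Oplus>\<^bsub>M\<^esub>j\<in>{1..k - 1}. (- 1) ^ j \<odot>\<^bsub>M\<^esub> rep_ops (k - 1) n (nerve_face G k j c) e) =
    (\<Oplus>\<^bsub>M\<^esub>j\<in>{0..k}. (- 1) ^ j \<odot>\<^bsub>M\<^esub>
       rep_ops j (n + 1 - int (k - j)) (nerve_front j c) (rep_ops (k - j) n (nerve_back G k j c) e))"
proof -
  obtain v where e: "e = (fst c, v)" and v: "v \<in> {..<rk n} \<rightarrow>\<^sub>E UNIV"
    using e c by (auto simp: nerve_src_eq)
  have M: "M = coord_fibre (rk (n + 2 - int k)) (fst c)"
    by (simp add: M nerve_tgt_def)
  have L: "rep_ops (k - 1) n (nerve_face G k j c) e =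
      (fst c, mat_apply (rk (n + 2 - int k)) (rk n) (rep_mat (k - 1) (nerve_face G k j c)) v)"
    if "j \<in> {1..k - 1}" for j
  proof -
    \<comment> \<open>An index \<open>j\<close> in this range forces \<open>k \<ge> 2\<close>, so
      the subtraction \<open>k - 1\<close> on naturals is exact.\<close>
    have j: "1 \<le> j" "j < k" and k: "n + 1 - int (k - 1) = n + 2 - int k"
      using that by auto
    have "fst (nerve_face G k j c) = fst c"
      by (simp add: nerve_face_def)
    from rep_ops_apply[OF nerve_src_face[OF c j] this v] show ?thesis
      by (simp only: e k)
  qed
  have R: "rep_ops j (n + 1 - int (k - j)) (nerve_front j c) (rep_ops (k - j) n (nerve_back G k j c) e) =
    (fst c, mat_apply (rk (n + 2 - int k)) (rk (n + 1 - int (k - j))) (rep_mat j (nerve_front j c))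
       (mat_apply (rk (n + 1 - int (k - j))) (rk n) (rep_mat (k - j) (nerve_back G k j c)) v))"
    if "j \<in> {0..k}" for j
  proof -
    have j: "j \<le> k" "n + 1 - int (k - j) + 1 - int j = n + 2 - int k"
      using that by auto
    have "fst (nerve_back G k j c) = fst c" "fst (nerve_front j c) = fst c"
      using nerve_src_eq[OF c j(1)] by (simp_all add: nerve_back_def nerve_front_def)
    then show ?thesis
      unfolding e
      by (subst rep_ops_apply[OF nerve_src_back[OF c j(1)] _ v], simp,
          subst rep_ops_apply[OF nerve_src_front[OF c j(1)]])
        (simp_all only: j mat_apply_PiE)
  qed
  show ?thesis
    unfolding M
    by (simp add: finsum_coord_fibre L R mat_apply_PiE rep_equation_coords[OF c]
        del: One_nat_def of_nat_diff cong: restrict_cong)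
qed

section \<open>Unitality up to homotopy\<close>

definition rep_homotopy :: "int \<Rightarrow> 'x \<Rightarrow> 'x \<times> (nat \<Rightarrow> 'k) \<Rightarrow> 'x \<times> (nat \<Rightarrow> 'k)"
  where "rep_homotopy n y = (\<lambda>e\<in>carrier (coord_fibre (rk n) y).
    (y, mat_apply (rk (n - 1)) (rk n) (\<lambda>(i, j). if i = j then - 1 else 0) (snd e)))"

lemma hom_section_rep_homotopy:
  "hom_section (Obj G) id (rep_bundle n) id (rep_bundle (n - 1)) (rep_homotopy n)"
  using hom_section_trivial_bundle[of id "Obj G" "Obj G" id "Obj G" "rk (n - 1)" "rk n"
      "\<lambda>_ (i, j). if i = j then - 1 else (0::'k)"]
  by (simp add: rep_bundle_def rep_homotopy_def[abs_def])

text \<open>R_1 on a unit is the scalar \<theta>, and \<theta> - 1 is the product of 1 - \<theta>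
  and - 1. In degree 0 only the second summand on the right contributes, in degree 1 only the
  first.\<close>

lemma rep_ops_unital:
  assumes y: "y \<in> topspace (Obj G)" and e: "e \<in> carrier (fibre (rep_bundle n) y)"
  shows "rep_ops 1 n (arr_simplex G (idt G y)) e \<ominus>\<^bsub>fibre (rep_bundle n) y\<^esub> e =
    rep_diff rep_ops y (n - 1) (rep_homotopy n y e) \<oplus>\<^bsub>fibre (rep_bundle n) y\<^esub>
    rep_homotopy (n + 1) y (rep_diff rep_ops y n e)"
proof -
  obtain v where e: "e = (y, v)" and v: "v \<in> {..<rk n} \<rightarrow>\<^sub>E UNIV"
    using e by auto
  have R1: "rep_ops 1 n (arr_simplex G (idt G y)) (y, v) =
      (y, mat_apply (rk n) (rk n) (S (idt G y)) v)"
    using y v by (subst rep_ops_apply)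
      (simp_all add: nerve_src_def arr_simplex_def src_idt tgt_idt rep_mat_def)
  have R0: "rep_diff rep_ops y m (y, w) =
      (y, mat_apply (rk (m + 1)) (rk m) (\<lambda>(i, j). if i = j then 1 - \<theta> y else 0) w)"
    if "w \<in> {..<rk m} \<rightarrow>\<^sub>E UNIV" for m w
    using that unfolding rep_diff_def
    by (subst rep_ops_apply) (simp_all add: nerve_src_def obj_simplex_def rep_mat_def cong: if_cong)
  have h: "rep_homotopy m y (y, w) = (y, mat_apply (rk (m - 1)) (rk m) (\<lambda>(i, j). if i = j then - 1 else 0) w)"
    if "w \<in> {..<rk m} \<rightarrow>\<^sub>E UNIV" for m w
    using that by (simp add: rep_homotopy_def)
  have coords: "mat_apply (rk n) (rk n) (S (idt G y)) v i - v i =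
    mat_apply (rk n) (rk (n - 1)) (\<lambda>(i, j). if i = j then 1 - \<theta> y else 0)
      (mat_apply (rk (n - 1)) (rk n) (\<lambda>(i, j). if i = j then - 1 else 0) v) i +
    mat_apply (rk n) (rk (n + 1)) (\<lambda>(i, j). if i = j then - 1 else 0)
      (mat_apply (rk (n + 1)) (rk n) (\<lambda>(i, j). if i = j then 1 - \<theta> y else 0) v) i"
    if i: "i < rk n" for i
  proof -
    from i have "i < d" and "n = 0 \<or> n = 1"
      by (auto simp: rk_def split: if_splits)
    then show ?thesis
      using y by (elim disjE; simp add: mat_apply_def rk_def mat_idt sum_diag_mult sum_negf)
        (simp_all add: algebra_simps)
  qed
  show ?thesis
    using v by (simp add: e R0 R1 h mat_apply_PiE minus_coord_fibre coords
        del: One_nat_def cong: restrict_cong)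
qed

theorem homotopy_representation_rep_ops: "homotopy_representation G rep_bundle rep_ops"
  unfolding homotopy_representation_def Let_def
proof (intro conjI allI ballI)
  show "\<exists>\<Upsilon>. (\<forall>n. hom_section (Obj G) id (rep_bundle n) id (rep_bundle (n - 1)) (\<Upsilon> n)) \<and>
       (\<forall>n. \<forall>x\<in>topspace (Obj G). \<forall>e\<in>carrier (fibre (rep_bundle n) x).
          rep_ops 1 n (arr_simplex G (idt G x)) e \<ominus>\<^bsub>fibre (rep_bundle n) x\<^esub> e =
          rep_diff rep_ops x (n - 1) (\<Upsilon> n x e) \<oplus>\<^bsub>fibre (rep_bundle n) x\<^esub>
          \<Upsilon> (n + 1) x (rep_diff rep_ops x n e))"
    using hom_section_rep_homotopy rep_ops_unital
    by (intro exI[of _ rep_homotopy] conjI allI ballI) simp_all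
qed (use rep_equation in \<open>simp_all only: graded_vector_bundle_rep_bundle hom_section_rep_ops\<close>)

section \<open>Cohomology at the base point\<close>

lemma equivalent_reps_cohomology:
  fixes V :: "('k, 'v) module"
  assumes "\<theta> x = 1" and T: "linear_iso (coord_space d) V T"
    and equivariant: "\<And>g v. \<lbrakk>g \<in> carrier (isotropy G x); v \<in> {..<d} \<rightarrow>\<^sub>E UNIV\<rbrakk>
      \<Longrightarrow> T (mat_apply d d (S g) v) = \<rho> g (T v)"
  shows "equivalent_reps (isotropy G x) (cohomology rep_bundle rep_ops 0 x)
    (cohomology_action G rep_bundle rep_ops 0) V \<rho>"
proof -
  let ?M = "coord_fibre d x :: ('k, 'x \<times> (nat \<Rightarrow> 'k)) module"
  let ?H = "cohomology rep_bundle rep_ops 0 x"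
  \<comment> \<open>The differential at \<open>x\<close> is multiplication by 1 - \<theta> or has
    rank zero source or target; it vanishes in either case.\<close>
  have diff: "rep_diff rep_ops x n (x, w) = (x, \<lambda>i\<in>{..<rk (n + 1)}. 0)"
    if "w \<in> {..<rk n} \<rightarrow>\<^sub>E UNIV" for n w
    using that \<open>\<theta> x = 1\<close> unfolding rep_diff_def
    by (subst rep_ops_apply)
      (simp_all add: nerve_src_def obj_simplex_def rep_mat_def mat_apply_def cong: if_cong)
  have rk: "rk 0 = d" "rk (- 1) = 0"
    by (simp_all add: rk_def)
  \<comment> \<open>Degree -1 has rank zero, so its fibre has a single element, whose second
    component is the everywhere undefined function.\<close>
  have B: "coboundaries rep_bundle rep_ops 0 x = {\<zero>\<^bsub>?M\<^esub>}"
  proof -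
    have "carrier (coord_fibre 0 x) = {(x, (\<lambda>_. undefined) :: nat \<Rightarrow> 'k)}"
      by simp
    then show ?thesis
      using diff[of "\<lambda>_. undefined" "-1"] by (simp add: coboundaries_def rk)
  qed
  have Z: "cocycles rep_bundle rep_ops 0 x = carrier ?M"
    using diff[of _ 0] by (auto simp: cocycles_def rk simp del: PiE_iff)
  have H: "carrier ?H = (\<lambda>v. {(x, v)}) ` ({..<d} \<rightarrow>\<^sub>E UNIV)"
  proof -
    have "carrier ?H = {{\<zero>\<^bsub>?M\<^esub>} +>\<^bsub>?M\<^esub> z | z. z \<in> carrier ?M}"
      by (simp add: cohomology_def Let_def rk B Z del: zero_coord_fibre carrier_coord_fibre)
    also have "\<dots> = (\<lambda>z. {z}) ` carrier ?M"
      unfolding setcompr_eq_image Collect_mem_eq by (rule image_cong[OF refl zero_coset])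
    also have "\<dots> = (\<lambda>v. {(x, v)}) ` ({..<d} \<rightarrow>\<^sub>E UNIV)"
      by (auto simp: image_iff simp del: PiE_iff)
    finally show ?thesis .
  qed
  have H_add: "{(x, v)} \<oplus>\<^bsub>?H\<^esub> {(x, w)} = {(x, \<lambda>i\<in>{..<d}. v i + w i)}" for v w
    by (simp add: cohomology_def Let_def rk set_add_singleton)
  have H_smult: "a \<odot>\<^bsub>?H\<^esub> {(x, v)} = {(x, \<lambda>i\<in>{..<d}. a * v i)}" for a v
    by (simp add: cohomology_def Let_def rk B zero_coset del: zero_coord_fibre)
  have action: "cohomology_action G rep_bundle rep_ops 0 g {(x, v)} = {(x, mat_apply d d (S g) v)}"
    if g: "g \<in> carrier (isotropy G x)" and v: "v \<in> {..<d} \<rightarrow>\<^sub>E UNIV" for g v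
  proof -
    have g: "src G g = x" "tgt G g = x"
      using g by (simp_all add: isotropy_def)
    then have "rep_ops 1 0 (arr_simplex G g) (x, v) = (x, mat_apply d d (S g) v)"
      using v by (subst rep_ops_apply) (simp_all add: nerve_src_def arr_simplex_def rk rep_mat_def)
    then show ?thesis
      by (simp add: cohomology_action_def g B rk zero_coset mat_apply_PiE
          del: zero_coord_fibre One_nat_def)
  qed
  have lin: "linear_on (coord_space d) V T" and bij: "bij_betw T ({..<d} \<rightarrow>\<^sub>E UNIV) (carrier V)"
    using T by (simp_all add: linear_iso_def)
  \<comment> \<open>Every class is a singleton {(x, v)}; the equivalence extracts \<open>v\<close>
    and applies \<open>T\<close>.\<close>
  let ?T = "\<lambda>C. T (snd (the_elem C))"
  have "linear_on ?H V ?T"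
    using lin unfolding linear_on_def H by (simp add: H_add H_smult Pi_iff)
  moreover have "bij_betw ?T (carrier ?H) (carrier V)"
  proof -
    have "bij_betw (\<lambda>C. snd (the_elem C)) (carrier ?H) ({..<d} \<rightarrow>\<^sub>E UNIV)"
      unfolding H by (rule bij_betw_byWitness[where f' = "\<lambda>v. {(x, v)}"]) (simp_all add: image_image)
    from bij_betw_trans[OF this bij] show ?thesis
      by (simp add: o_def)
  qed
  moreover have "?T (cohomology_action G rep_bundle rep_ops 0 g C) = \<rho> g (?T C)"
    if g: "g \<in> carrier (isotropy G x)" and C: "C \<in> carrier ?H" for g C
  proof -
    obtain v where "C = {(x, v)}" "v \<in> {..<d} \<rightarrow>\<^sub>E UNIV"
      using C unfolding H by blast
    then show ?thesis
      using g by (simp add: action equivariant)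
  qed
  ultimately show ?thesis
    unfolding equivalent_reps_def linear_iso_def by blast
qed

end

section \<open>Extending a representation of an isotropy group\<close>

context bundle_of_compact_groups
begin

text \<open>
  A local trivialization \<open>\<phi>\<close> around \<open>x\<close> gives \<open>r (\<phi> (k, u)) = \<phi> (k, x)\<close>.
\<close>

lemma local_retraction:
  assumes x: "x \<in> topspace (Obj G)"
  obtains U r where "openin (Obj G) U" "x \<in> U"
    "continuous_map (subtopology (Arr G) {g \<in> topspace (Arr G). src G g \<in> U}) (isotropy_topology G x) r"
    "\<And>g h. \<lbrakk>g \<in> topspace (Arr G); h \<in> topspace (Arr G); src G g \<in> U; src G g = tgt G h\<rbrakk>
       \<Longrightarrow> r (cmp G g h) = cmp G (r g) (r h)"
    "\<And>g. \<lbrakk>g \<in> topspace (Arr G); src G g = x\<rbrakk> \<Longrightarrow> r g = g"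
proof -
  obtain U and K :: "'g monoid" and T \<phi> where U: "openin (Obj G) U" "x \<in> U"
    and K: "topological_group K T"
    and \<phi>: "homeomorphic_map (prod_topology T (subtopology (Obj G) U))
           (subtopology (Arr G) {g \<in> topspace (Arr G). src G g \<in> U}) \<phi>"
    and src_\<phi>: "\<And>k u. k \<in> carrier K \<Longrightarrow> u \<in> U \<Longrightarrow> src G (\<phi> (k, u)) = u"
    and mult_\<phi>: "\<And>k l u. k \<in> carrier K \<Longrightarrow> l \<in> carrier K \<Longrightarrow> u \<in> U \<Longrightarrow>
      \<phi> (k \<otimes>\<^bsub>K\<^esub> l, u) = cmp G (\<phi> (k, u)) (\<phi> (l, u))"
    using locally_trivial[OF x] by (elim exE conjE) (rule that, assumption+, simp_all)
  let ?P = "prod_topology T (subtopology (Obj G) U)"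
  let ?A = "subtopology (Arr G) {g \<in> topspace (Arr G). src G g \<in> U}"
  have "U \<subseteq> topspace (Obj G)"
    using U openin_subset by blast
  then have topU: "topspace (subtopology (Obj G) U) = U"
    by auto
  have topT: "topspace T = carrier K" and grp: "group K"
    using K by (simp_all add: topological_group_def)
  obtain \<psi> where "homeomorphic_maps ?P ?A \<phi> \<psi>"
    using \<phi> homeomorphic_map_maps by blast
  then have cont: "continuous_map ?P ?A \<phi>" "continuous_map ?A ?P \<psi>"
    and \<psi>\<phi>: "\<And>k u. k \<in> carrier K \<Longrightarrow> u \<in> U \<Longrightarrow> \<psi> (\<phi> (k, u)) = (k, u)"
    and \<phi>\<psi>: "\<And>g. g \<in> topspace (Arr G) \<Longrightarrow> src G g \<in> U \<Longrightarrow> \<phi> (\<psi> g) = g"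
    using \<open>U \<subseteq> topspace (Obj G)\<close> by (auto simp: homeomorphic_maps_def topT)
  \<comment> \<open>Every arrow over \<open>U\<close> is a value of \<open>\<phi>\<close> at its own
    base point, so the algebraic claims about \<open>r\<close> reduce to multiplicativity of
    \<open>\<phi>\<close> over \<open>U\<close> and over \<open>x\<close>.\<close>
  have decomp: "\<exists>k\<in>carrier K. g = \<phi> (k, src G g)" if "g \<in> topspace (Arr G)" "src G g \<in> U" for g
  proof -
    have "\<psi> g \<in> topspace ?P"
      using continuous_map_image_subset_topspace[OF cont(2)] that by auto
    then have "fst (\<psi> g) \<in> carrier K" "snd (\<psi> g) \<in> U"
      by (auto simp: topT topU)
    then show ?thesis
      using \<phi>\<psi>[OF that] src_\<phi>[of "fst (\<psi> g)" "snd (\<psi> g)"] by (metis prod.collapse)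
  qed
  define r where "r g = \<phi> (fst (\<psi> g), x)" for g
  have r: "r (\<phi> (k, u)) = \<phi> (k, x)" if "k \<in> carrier K" "u \<in> U" for k u
    using that by (simp add: r_def \<psi>\<phi>)
  have in_arr: "\<phi> (k, u) \<in> topspace (Arr G)" if "k \<in> carrier K" "u \<in> U" for k u
  proof -
    have "(k, u) \<in> topspace ?P"
      using that by (simp add: topT topU del: topspace_subtopology)
    then have "\<phi> (k, u) \<in> topspace ?A"
      using continuous_map_image_subset_topspace[OF cont(1)] by blast
    then show ?thesis
      by simp
  qed
  show ?thesis
  proof
    have "continuous_map ?A ?P (\<lambda>g. (fst (\<psi> g), x))"
      using cont(2) U x
      by (auto simp: continuous_map_pairwise o_def topU intro: continuous_map_compose[OF cont(2) continuous_map_fst, unfolded o_def])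
    from continuous_map_compose[OF this cont(1)] have "continuous_map ?A (Arr G) r"
      by (simp add: o_def r_def[abs_def] continuous_map_in_subtopology)
    moreover have "r g \<in> carrier (isotropy G x)" if "g \<in> topspace (Arr G)" "src G g \<in> U" for g
    proof -
      obtain k where "k \<in> carrier K" "g = \<phi> (k, src G g)"
        using decomp[OF \<open>g \<in> topspace (Arr G)\<close> \<open>src G g \<in> U\<close>] by blast
      then have "r g = \<phi> (k, x)" and k: "k \<in> carrier K"
        using r that by metis+
      then show ?thesis
        using k U in_arr[OF k U(2)] src_\<phi>[OF k U(2)] src_eq_tgt[OF in_arr[OF k U(2)]]
        by (simp add: isotropy_def)
    qed
    ultimately show "continuous_map ?A (isotropy_topology G x) r"
      by (auto simp: isotropy_topology_def continuous_map_in_subtopology)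
    show "r (cmp G g h) = cmp G (r g) (r h)"
      if gh: "g \<in> topspace (Arr G)" "h \<in> topspace (Arr G)" "src G g \<in> U" "src G g = tgt G h" for g h
    proof -
      have h: "src G h = src G g"
        using gh src_eq_tgt by simp
      obtain k l where kl: "k \<in> carrier K" "l \<in> carrier K"
        and g: "g = \<phi> (k, src G g)" and h: "h = \<phi> (l, src G g)"
        using decomp[of g] decomp[of h] gh h by metis
      have "cmp G g h = \<phi> (k \<otimes>\<^bsub>K\<^esub> l, src G g)"
        using mult_\<phi>[OF kl gh(3)] g h by simp
      then have "r (cmp G g h) = \<phi> (k \<otimes>\<^bsub>K\<^esub> l, x)"
        using r gh(3) kl group.is_monoid[OF grp] monoid.m_closed by metis
      also have "\<dots> = cmp G (\<phi> (k, x)) (\<phi> (l, x))"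
        by (rule mult_\<phi>[OF kl U(2)])
      also have "\<dots> = cmp G (r g) (r h)"
        using g h r kl gh(3) by metis
      finally show ?thesis .
    qed
    show "r g = g" if "g \<in> topspace (Arr G)" "src G g = x" for g
      using decomp[of g] that r U by metis
  qed (use U in auto)
qed

text \<open>A locally compact Hausdorff space is completely regular: some function is 0 at
  \<open>x\<close> and 1 off \<open>U\<close>, and one minus it is the bump.\<close>

lemma bump_function:
  assumes "openin (Obj G) U" "x \<in> U"
  obtains f :: "'x \<Rightarrow> real" where "continuous_map (Obj G) euclideanreal f" "f x = 1"
    "\<And>y. y \<in> topspace (Obj G) \<Longrightarrow> y \<notin> U \<Longrightarrow> f y = 0"
proof -
  have "completely_regular_space (Obj G)"
    using loc_compact(1) Hausdorff_Obj
    by (simp add: locally_compact_regular_imp_completely_regular_space locally_compact_Hausdorff_imp_regular_space)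
  moreover have "closedin (Obj G) (topspace (Obj G) - U)" "x \<in> topspace (Obj G) - (topspace (Obj G) - U)"
    using assms openin_subset by blast+
  ultimately obtain h :: "'x \<Rightarrow> real" where h: "continuous_map (Obj G) euclideanreal h" "h x = 0"
      "h ` (topspace (Obj G) - U) \<subseteq> {1}"
    unfolding completely_regular_space_def continuous_map_in_subtopology by metis
  show ?thesis
  proof (rule that[of "\<lambda>y. 1 - h y"])
    show "continuous_map (Obj G) euclideanreal (\<lambda>y. 1 - h y)"
      by (intro continuous_map_diff h(1)) simp
  qed (use h in auto)
qed

text \<open>The representation is pulled back along the retraction \<open>r\<close> over
  \<open>U\<close>, multiplied by a scale \<open>\<theta>\<close> supported where the bump
  \<open>f\<close> is at least 1/2, and extended by zero.\<close>

lemma scaled_representation_exists: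
  fixes V :: "('k::real_normed_field, 'v) module"
  assumes x: "x \<in> topspace (Obj G)" and T: "linear_iso (coord_space d) V T"
    and \<rho>: "continuous_representation (isotropy G x) (isotropy_topology G x) V \<rho>"
  obtains \<theta> S where "scaled_representation G d \<theta> S" "\<theta> x = 1"
    "\<And>g. g \<in> carrier (isotropy G x) \<Longrightarrow> S g = rep_matrix d T (\<rho> g)"
proof -
  obtain U r where U: "openin (Obj G) U" "x \<in> U"
    and r_cont: "continuous_map (subtopology (Arr G) {g \<in> topspace (Arr G). src G g \<in> U}) (isotropy_topology G x) r"
    and r_cmp: "\<And>g h. \<lbrakk>g \<in> topspace (Arr G); h \<in> topspace (Arr G); src G g \<in> U; src G g = tgt G h\<rbrakk>
       \<Longrightarrow> r (cmp G g h) = cmp G (r g) (r h)"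
    and r_id: "\<And>g. \<lbrakk>g \<in> topspace (Arr G); src G g = x\<rbrakk> \<Longrightarrow> r g = g"
    by (rule local_retraction[OF x]) (rule that)
  obtain f :: "'x \<Rightarrow> real" where f: "continuous_map (Obj G) euclideanreal f" "f x = 1"
    and f_supp: "\<And>y. y \<in> topspace (Obj G) \<Longrightarrow> y \<notin> U \<Longrightarrow> f y = 0"
    using bump_function[OF U] by blast
  interpret action: group_action "isotropy G x" "carrier V" \<rho>
    using \<rho> by (simp add: continuous_representation_def)
  interpret group "isotropy G x"
    using action.group_hom by (simp add: group_hom_def)
  have linear: "linear_on V V (\<rho> g)" if "g \<in> carrier (isotropy G x)" for g
    using \<rho> that by (simp add: continuous_representation_def)
  have src_obj: "src G g \<in> topspace (Obj G)" if "g \<in> topspace (Arr G)" for g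
    using continuous_map_image_subset_topspace[OF src_cont] that by auto
  have r_iso: "r g \<in> carrier (isotropy G x)" if "g \<in> topspace (Arr G)" "src G g \<in> U" for g
    using continuous_map_image_subset_topspace[OF r_cont] that by (auto simp: isotropy_topology_def)
  \<comment> \<open>This keeps the value 1 at \<open>x\<close> and vanishes for
    \<open>f \<le> 1/2\<close>. The cut at 1/2 puts the support in a closed set inside
    \<open>U\<close>, whereas \<open>f\<close> itself may be nonzero at points of \<open>U\<close>
    arbitrarily close to its boundary.\<close>
  define \<theta> :: "'x \<Rightarrow> 'k" where "\<theta> y = of_real (max 0 (2 * f y - 1))" for y
  define m where "m g = rep_matrix d T (\<rho> (r g))" for g
  define S where "S g = (\<lambda>(i, j)\<in>{..<d} \<times> {..<d}. if 1 / 2 \<le> f (src G g) then \<theta> (src G g) * m g (i, j) else 0)" for g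
  have supp: "y \<in> U" if "1 / 2 \<le> f y" "y \<in> topspace (Obj G)" for y
    using f_supp[of y] that by fastforce
  have theta0: "\<theta> y = 0" if "\<not> 1 / 2 \<le> f y" for y
    using that by (simp add: \<theta>_def)
  have theta_cont: "continuous_map (Obj G) euclidean \<theta>"
  proof -
    have "continuous_map (Obj G) euclideanreal (\<lambda>y. max 0 (2 * f y - 1))"
      by (intro continuous_intros f(1)) auto
    from continuous_map_compose[OF this, of euclidean "of_real :: real \<Rightarrow> 'k"] show ?thesis
      by (simp add: \<theta>_def[abs_def] o_def continuous_on_of_real_id)
  qed
  show ?thesis
  proof
    show "scaled_representation G d \<theta> S"
    proof
      show "continuous_map (Obj G) euclidean \<theta>"
        by (rule theta_cont)
      show "continuous_map (Arr G) euclidean (\<lambda>g. S g (i, j))" if ij: "i < d" "j < d" for i j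
      proof -
        note comp = continuous_map_compose[unfolded o_def]
        let ?A = "subtopology (Arr G) {g \<in> topspace (Arr G). src G g \<in> U}"
        \<comment> \<open>\<open>rep_matrix\<close> unfolds to the very expression in
          \<open>continuous_representation\<close>, here composed with \<open>r\<close>.\<close>
        have "continuous_map ?A (matrix_topology d d) m"
          using comp[OF r_cont] \<rho> T unfolding m_def rep_matrix_def continuous_representation_def by blast
        then have m: "continuous_map ?A euclidean (\<lambda>g. m g (i, j))"
          using ij comp[OF _ continuous_map_product_projection[of "(i, j)" "{..<d} \<times> {..<d}" "\<lambda>_. euclidean"]]
          unfolding matrix_topology_def by auto
        have th: "continuous_map (Arr G) euclidean (\<lambda>g. \<theta> (src G g))"
          by (rule comp[OF src_cont theta_cont])
        have "continuous_map ?A euclidean (\<lambda>g. \<theta> (src G g) * m g (i, j))"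
        proof -
          have "continuous_map ?A (prod_topology euclidean euclidean) (\<lambda>g. (\<theta> (src G g), m g (i, j)))"
            using m continuous_map_from_subtopology[OF th] by (simp add: continuous_map_pairwise o_def del: prod_topology_euclidean)
          then show ?thesis
            using comp[of ?A "prod_topology euclidean euclidean" "\<lambda>g. (\<theta> (src G g), m g (i, j))"
                euclidean "\<lambda>p. fst p * snd p"]
            by (simp add: continuous_on_mult continuous_on_fst continuous_on_snd)
        qed
        then have "continuous_map (subtopology (Arr G) {g \<in> topspace (Arr G). 1 / 2 \<le> f (src G g)})
            euclidean (\<lambda>g. \<theta> (src G g) * m g (i, j))"
          by (rule continuous_map_from_subtopology_mono) (auto intro: supp src_obj)
        \<comment> \<open>Pasting along the two closed sets \<open>f \<ge> 1/2\<close> and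
          \<open>f \<le> 1/2\<close>: where they meet, \<theta> is zero and both branches
          agree.\<close>
        then have "continuous_map (Arr G) euclidean (\<lambda>g. if 1 / 2 \<le> f (src G g) then \<theta> (src G g) * m g (i, j) else 0)"
        proof (intro continuous_map_cases_le)
          show "continuous_map (Arr G) euclideanreal (\<lambda>g. f (src G g))"
            by (rule comp[OF src_cont f(1)])
          show "\<theta> (src G g) * m g (i, j) = 0" if "1 / 2 = f (src G g)" for g
            using that by (simp add: \<theta>_def flip: that)
        qed simp_all
        then show ?thesis
          using ij by (simp add: S_def)
      qed
      show "(\<Sum>l<d. S g (i, l) * S h (l, j)) = \<theta> (tgt G g) * S (cmp G g h) (i, j)"
        if gh: "g \<in> topspace (Arr G)" "h \<in> topspace (Arr G)" "src G g = tgt G h" and ij: "i < d" "j < d" for g h i j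
      proof (cases "1 / 2 \<le> f (src G g)")
        case True
        have src: "tgt G h = src G g" "src G h = src G g" "tgt G g = src G g" "src G (cmp G g h) = src G g"
          using gh src_cmp src_eq_tgt by metis+
        have gU: "src G g \<in> U"
          using supp[OF True] src_obj gh by blast
        then have hU: "src G h \<in> U"
          using src by simp
        have "\<rho> (r (cmp G g h)) v = \<rho> (r g) (\<rho> (r h) v)" if "v \<in> carrier V" for v
          unfolding r_cmp[OF gh(1,2) gU gh(3)]
          using action.composition_rule[OF that r_iso[OF gh(1) gU] r_iso[OF gh(2) hU]]
          by (simp add: isotropy_def)
        then have "m (cmp G g h) = rep_matrix d T (\<lambda>v. \<rho> (r g) (\<rho> (r h) v))"
          unfolding m_def by (rule rep_matrix_cong[OF T])
        then have "(\<Sum>l<d. m g (i, l) * m h (l, j)) = m (cmp G g h) (i, j)"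
          using rep_matrix_mult[OF T linear[OF r_iso[OF gh(1) gU]] linear[OF r_iso[OF gh(2) hU]] ij]
          by (simp only: m_def)
        \<comment> \<open>Both factors \<open>S\<close> carry a \<theta>, one more than
          \<open>S (cmp G g h)\<close>; this is the extra \<theta> in
          \<open>mat_cmp\<close>.\<close>
        then have "\<theta> (src G g) * (\<theta> (src G g) * (\<Sum>l<d. m g (i, l) * m h (l, j))) =
            \<theta> (src G g) * (\<theta> (src G g) * m (cmp G g h) (i, j))"
          by simp
        then show ?thesis
          using True ij by (simp add: S_def src sum_distrib_left mult_ac)
      next
        case False
        then show ?thesis
          using gh ij src_eq_tgt[of g] by (simp add: S_def theta0)
      qed
      show "S (idt G y) (i, j) = (if i = j then \<theta> y else 0)"
        if y: "y \<in> topspace (Obj G)" and ij: "i < d" "j < d" for y i j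
      proof (cases "1 / 2 \<le> f y")
        case True
        have 1: "idt G y \<in> topspace (Arr G)" "src G (idt G y) = y" "tgt G (idt G y) = y"
          using continuous_map_image_subset_topspace[OF idt_cont] y src_idt tgt_idt by auto
        have yU: "y \<in> U"
          using supp True y by blast
        \<comment> \<open>The unit is idempotent, hence so is its image under the multiplicative
          \<open>r\<close>, and an idempotent of a group is the identity.\<close>
        have "cmp G (idt G y) (idt G y) = idt G y"
          using idt_cmp[OF 1(1)] 1 by simp
        then have "r (idt G y) \<otimes>\<^bsub>isotropy G x\<^esub> r (idt G y) = r (idt G y)"
          using r_cmp[of "idt G y" "idt G y"] 1 yU by (simp add: isotropy_def)
        then have "r (idt G y) = \<one>\<^bsub>isotropy G x\<^esub>"
          using r_iso[of "idt G y"] 1 yU l_cancel_one by metis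
        then have "\<rho> (r (idt G y)) v = v" if "v \<in> carrier V" for v
          using that action.id_eq_one by (metis restrict_apply')
        then have "m (idt G y) (i, j) = (if i = j then 1 else 0)"
          unfolding m_def by (rule rep_matrix_id[OF T _ ij])
        then show ?thesis
          using True ij 1 by (simp add: S_def)
      next
        case False
        then show ?thesis
          using y ij by (simp add: S_def theta0 src_idt)
      qed
    qed
    show "\<theta> x = 1"
      by (simp add: \<theta>_def f)
    show "S g = rep_matrix d T (\<rho> g)" if "g \<in> carrier (isotropy G x)" for g
      using that by (auto simp: S_def isotropy_def \<theta>_def f m_def r_id rep_matrix_def fun_eq_iff)
  qed
qed

end

theorem proposition2:
  fixes G :: "('x, 'g) groupoid"
    and x :: 'x
    and V :: "('k::real_normed_field, 'v) module"
    and \<rho> :: "'g \<Rightarrow> 'v \<Rightarrow> 'v"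
  assumes "bundle_of_compact_groups G"
    and "x \<in> topspace (Obj G)"
    and "finite_dim_space V"
    and "continuous_representation (isotropy G x) (isotropy_topology G x) V \<rho>"
  shows "\<exists>(E :: int \<Rightarrow> ('k, 'x, 'x \<times> (nat \<Rightarrow> 'k)) vbundle) R.
    homotopy_representation G E R \<and>
    equivalent_reps (isotropy G x) (cohomology E R 0 x) (cohomology_action G E R 0) V \<rho>"
proof -
  interpret bundle_of_compact_groups G
    by fact
  obtain d T where T: "linear_iso (coord_space d) V T"
    using assms(3) by (auto simp: finite_dim_space_def)
  obtain \<theta> S where "scaled_representation G d \<theta> S" and \<theta>: "\<theta> x = 1"
    and S: "\<And>g. g \<in> carrier (isotropy G x) \<Longrightarrow> S g = rep_matrix d T (\<rho> g)"
    by (rule scaled_representation_exists[OF assms(2) T assms(4)]) (rule that)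
  then interpret scaled_representation G d \<theta> S
    by simp
  have linear: "linear_on V V (\<rho> g)" if "g \<in> carrier (isotropy G x)" for g
    using assms(4) that by (simp add: continuous_representation_def)
  \<comment> \<open>\<open>S g\<close> is the matrix of \<open>\<rho> g\<close> in the basis
    \<open>T\<close>, so \<open>T\<close> intertwines the two.\<close>
  have "T (mat_apply d d (S g) v) = \<rho> g (T v)"
    if g: "g \<in> carrier (isotropy G x)" and v: "v \<in> {..<d} \<rightarrow>\<^sub>E UNIV" for g v
  proof -
    have "\<rho> g (T v) \<in> carrier V"
      using T v linear[OF g] unfolding linear_iso_def linear_on_def by (simp add: Pi_iff)
    then show ?thesis
      using linear_iso_coords(2)[OF T] by (simp add: S g rep_matrix_apply[OF T linear[OF g] v])
  qed
  from equivalent_reps_cohomology[OF \<theta> T this] homotopy_representation_rep_ops show ?thesis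
    by blast
qed

end
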